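(* Let $\Omega$ be a closed subset of $\mathcal{M}_{\mathcal{F}}$ equipped with the $\tau_{\mathcal{F}}$-topology. Assume that $\phi(\Omega,P)<\infty$ and that there exist numbers $1<r,k<+\infty$ with $r^{-1}+k^{-1}=1$ such that $$\lim_{|x|\to\infty}\frac{\varphi(x)}{|x|^{r}}>0$$ and $\|f\|_k<\infty$ for every $f\in\mathcal{F}$. Then there exists at least one $\phi$-projection of $P$ on $\Omega$.
   Context: $(\mathcal{X},\mathcal{B})$ is a measurable space and $P$ a given probability measure on it. $\|\cdot\|_k$ is the usual norm of $L_k(\mathcal{X},P)$. $\mathcal{M}$ is the real vector space of all signed finite measures on $(\mathcal{X},\mathcal{B})$, and $\mathcal{M}(P)$ the subspace of those absolutely continuous w.r.t. $P$. The function $\varphi:\mathbb{R}\to[0,+\infty]$ is proper, convex and closed, with $\varphi(1)=0$, and its domain $\{x:\varphi(x)<\infty\}$ is an interval with endpoints $a_\varphi<1<b_\varphi$ (finite or infinite). Closed means that $\varphi(x)\to\varphi(a_\varphi)$ as $x\downarrow a_\varphi$ if $a_\varphi$ is finite, and $\varphi(x)\to\varphi(b_\varphi)$ as $x\uparrow b_\varphi$ if $b_\varphi$ is finite (equivalently, $\varphi$ is lower semi-continuous). For $Q\in\mathcal{M}(P)$ put $\phi(Q,P):=\int_{\mathcal{X}}\varphi\left(\frac{dQ}{dP}\right)dP$, and $\phi(Q,P):=+\infty$ if $Q\in\mathcal{M}\setminus\mathcal{M}(P)$. For $\Omega\subseteq\mathcal{M}$, $\phi(\Omega,P):=\inf_{Q\in\Omega}\phi(Q,P)$.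 When $\phi(\Omega,P)<\infty$, a $\phi$-projection of $P$ on $\Omega$ is a measure $Q^*\in\Omega$ such that $\phi(Q^*,P)\le\phi(Q,P)$ for all $Q\in\Omega$. $\mathcal{F}$ is a class (not assumed finite) of measurable real valued functions on $\mathcal{X}$, bounded or unbounded; $\mathcal{B}_b$ is the set of all bounded measurable real valued functions on $\mathcal{X}$; $\mathcal{M}_{\mathcal{F}}:=\{Q\in\mathcal{M}:\int|f|\,d|Q|<\infty\text{ for all }f\in\mathcal{F}\}$, where $|Q|$ is the total variation of $Q$. The $\tau_{\mathcal{F}}$-topology is the weakest topology on $\mathcal{M}_{\mathcal{F}}$ for which all maps $Q\mapsto\int f\,dQ$, $f\in\mathcal{F}\cup\mathcal{B}_b$, are continuous. *)

theory Defs
  imports "HOL-Probability.Probability"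
begin

section \<open>Finite signed measures\<close>

text \<open>A finite signed measure on the measurable space underlying \<open>M\<close> is a real-valued countably
  additive set function on \<open>sets M\<close>. It is set to 0 off \<open>sets M\<close>, so that two signed
  measures that agree on \<open>sets M\<close> are equal.\<close>

definition signed_measures :: "'a measure \<Rightarrow> ('a set \<Rightarrow> real) set" where
  "signed_measures M = {Q. Q {} = 0 \<and>
     (\<forall>A::nat \<Rightarrow> 'a set. range A \<subseteq> sets M \<longrightarrow> disjoint_family A \<longrightarrow> (\<lambda>i. Q (A i)) sums Q (\<Union>i. A i)) \<and>
     (\<forall>A. A \<notin> sets M \<longrightarrow> Q A = 0)}"

text \<open>The Jordan decomposition: \<open>Q\<^sup>+(A) = sup {Q(B) | B \<subseteq> A}\<close> and \<open>Q\<^sup>- = (-Q)\<^sup>+\<close>. The truncation of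
  negative numbers by \<open>ennreal\<close> is harmless, because \<open>B = {}\<close> contributes 0.\<close>

definition pos_variation :: "'a measure \<Rightarrow> ('a set \<Rightarrow> real) \<Rightarrow> 'a measure" where
  "pos_variation M Q =
     measure_of (space M) (sets M) (\<lambda>A. SUP B\<in>{B\<in>sets M. B \<subseteq> A}. ennreal (Q B))"

definition neg_variation :: "'a measure \<Rightarrow> ('a set \<Rightarrow> real) \<Rightarrow> 'a measure" where
  "neg_variation M Q = pos_variation M (\<lambda>A. - Q A)"

definition total_variation :: "'a measure \<Rightarrow> ('a set \<Rightarrow> real) \<Rightarrow> 'a measure" where
  "total_variation M Q = measure_of (space M) (sets M)
     (\<lambda>A. emeasure (pos_variation M Q) A + emeasure (neg_variation M Q) A)"

definition signed_integral :: "'a measure \<Rightarrow> ('a set \<Rightarrow> real) \<Rightarrow> ('a \<Rightarrow> real) \<Rightarrow> real" where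
  "signed_integral M Q f =
     integral\<^sup>L (pos_variation M Q) f - integral\<^sup>L (neg_variation M Q) f"

definition signed_ac :: "'a measure \<Rightarrow> ('a set \<Rightarrow> real) \<Rightarrow> bool" where
  "signed_ac P Q \<longleftrightarrow> (\<forall>A\<in>sets P. emeasure P A = 0 \<longrightarrow> Q A = 0)"

text \<open>\<open>dQ/dP\<close>, determined up to \<open>P\<close>-null sets; meaningful for \<open>Q\<close> absolutely continuous
  with respect to \<open>P\<close>.\<close>

definition signed_RN_deriv :: "'a measure \<Rightarrow> ('a set \<Rightarrow> real) \<Rightarrow> 'a \<Rightarrow> real" where
  "signed_RN_deriv P Q =
     (SOME g. integrable P g \<and> (\<forall>A\<in>sets P. Q A = (LINT x:A|P. g x)))"


section \<open>Divergences and projections\<close>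

text \<open>\<open>a\<close> and \<open>b\<close> are the endpoints of the domain of \<open>\<phi>\<close>. Properness is implied, since 1 lies in
  the domain.\<close>

definition divergence_function :: "(real \<Rightarrow> ennreal) \<Rightarrow> ereal \<Rightarrow> ereal \<Rightarrow> bool" where
  "divergence_function \<phi> a b \<longleftrightarrow>
     (\<forall>x y t. 0 \<le> t \<longrightarrow> t \<le> 1 \<longrightarrow>
        \<phi> ((1 - t) * x + t * y) \<le> ennreal (1 - t) * \<phi> x + ennreal t * \<phi> y) \<and>
     \<phi> 1 = 0 \<and>
     a < 1 \<and> 1 < b \<and>
     {x. a < ereal x \<and> ereal x < b} \<subseteq> {x. \<phi> x < \<infinity>} \<and>
     {x. \<phi> x < \<infinity>} \<subseteq> {x. a \<le> ereal x \<and> ereal x \<le> b} \<and>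
     (\<forall>\<alpha>::real. a = ereal \<alpha> \<longrightarrow> (\<phi> \<longlongrightarrow> \<phi> \<alpha>) (at_right \<alpha>)) \<and>
     (\<forall>\<beta>::real. b = ereal \<beta> \<longrightarrow> (\<phi> \<longlongrightarrow> \<phi> \<beta>) (at_left \<beta>))"

definition phi_div :: "(real \<Rightarrow> ennreal) \<Rightarrow> ('a set \<Rightarrow> real) \<Rightarrow> 'a measure \<Rightarrow> ennreal" where
  "phi_div \<phi> Q P =
     (if signed_ac P Q then \<integral>\<^sup>+ x. \<phi> (signed_RN_deriv P Q x) \<partial>P else \<infinity>)"

definition phi_div_set :: "(real \<Rightarrow> ennreal) \<Rightarrow> ('a set \<Rightarrow> real) set \<Rightarrow> 'a measure \<Rightarrow> ennreal" where
  "phi_div_set \<phi> \<Omega> P = (INF Q\<in>\<Omega>. phi_div \<phi> Q P)"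

definition phi_projection ::
    "(real \<Rightarrow> ennreal) \<Rightarrow> 'a measure \<Rightarrow> ('a set \<Rightarrow> real) set \<Rightarrow> ('a set \<Rightarrow> real) \<Rightarrow> bool" where
  "phi_projection \<phi> P \<Omega> Q' \<longleftrightarrow> Q' \<in> \<Omega> \<and> (\<forall>Q\<in>\<Omega>. phi_div \<phi> Q' P \<le> phi_div \<phi> Q P)"


section \<open>The topology generated by a class of functions\<close>

definition bounded_measurable :: "'a measure \<Rightarrow> ('a \<Rightarrow> real) set" where
  "bounded_measurable M = {f \<in> borel_measurable M. \<exists>C. \<forall>x\<in>space M. \<bar>f x\<bar> \<le> C}"

definition signed_measures_on :: "'a measure \<Rightarrow> ('a \<Rightarrow> real) set \<Rightarrow> ('a set \<Rightarrow> real) set" where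
  "signed_measures_on M F =
     {Q \<in> signed_measures M. \<forall>f\<in>F. (\<integral>\<^sup>+ x. ennreal \<bar>f x\<bar> \<partial>total_variation M Q) < \<infinity>}"

definition tau_topology :: "'a measure \<Rightarrow> ('a \<Rightarrow> real) set \<Rightarrow> ('a set \<Rightarrow> real) topology" where
  "tau_topology M F = topology_generated_by
     {{Q \<in> signed_measures_on M F. signed_integral M Q f \<in> U} | f U.
        f \<in> F \<union> bounded_measurable M \<and> open U}"

lemma topspace_tau_topology: "topspace (tau_topology M F) = signed_measures_on M F"
proof -
  have "(\<lambda>_. 0) \<in> bounded_measurable M"
    by (auto simp: bounded_measurable_def)
  then have "\<exists>f U. signed_measures_on M F = {Q \<in> signed_measures_on M F. signed_integral M Q f \<in> U} \<and>
      f \<in> F \<union> bounded_measurable M \<and> open U"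
    by (intro exI[of _ "\<lambda>_. 0"] exI[of _ UNIV]) auto
  then show ?thesis
    unfolding tau_topology_def topology_generated_by_topspace by blast
qed


section \<open>The norm of L_k\<close>

text \<open>The \<open>k\<close>-th root is only taken of finite values, as \<open>powr\<close> is not available on \<open>ennreal\<close>.\<close>

definition Lp_norm :: "real \<Rightarrow> 'a measure \<Rightarrow> ('a \<Rightarrow> real) \<Rightarrow> ennreal" where
  "Lp_norm k P f =
     (let I = \<integral>\<^sup>+ x. ennreal (\<bar>f x\<bar> powr k) \<partial>P
      in if I = \<infinity> then \<infinity> else ennreal (enn2real I powr (1 / k)))"

end

theory Submission
  imports Defs
begin

text \<open>
  The proof is the direct method: sublevel sets of the divergence are compact enough for a minimising
  sequence to have a limit in \<open>\<Omega>\<close>, and the divergence is lower semicontinuous along that limit.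

  Let \<open>Q\<^sub>n \<in> \<Omega>\<close> be a minimising sequence with densities \<open>g\<^sub>n\<close>
  (\<open>signed_Radon_Nikodym\<close>). As \<open>\<phi>\<close> grows at least like \<open>\<bar>x\<bar> powr r\<close>, the \<open>g\<^sub>n\<close> lie in
  a fixed ball of \<open>L\<^sub>r\<close> (\<open>Lr_ball_of_divergence_bound\<close>). A diagonal argument would
  need countably many test functions, but \<open>F\<close> and the \<open>\<sigma>\<close>-algebra are arbitrary. Instead,
  Tychonoff's theorem for the bounded set functions \<open>A \<mapsto> Q\<^sub>n A\<close> gives a filter
  \<open>H\<close>, finer than the sequential one, along which \<open>Q\<^sub>n A\<close> tends to some \<open>l A\<close> for every set
  \<open>A\<close> (\<open>cluster_filter_of_bounded_sequence\<close>). Since \<open>r > 1\<close>, the \<open>g\<^sub>n\<close> are uniformly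
  integrable, and this makes \<open>l\<close> countably additive and absolutely continuous
  (\<open>weak_limit_signed_measure\<close>), with some density \<open>h\<close>.

  Convergence on measurable sets already yields lower semicontinuity. A convex lower semicontinuous
  \<open>\<phi>\<close> is the supremum of countably many affine functions
  (\<open>divergence_function_SUP_affine\<close>); the integral of an affine function of \<open>g\<^sub>n\<close> over a measurable
  set converges, and a maximum of finitely many of them becomes a sum of such integrals once the space
  is split according to which one is largest at \<open>h\<close> (\<open>weak_lower_semicontinuous\<close>). So the
  divergence of \<open>l\<close> does not exceed the infimum, and in particular \<open>h\<close> is itself in the ball
  of \<open>L\<^sub>r\<close>. Approximation of functions in \<open>L\<^sub>k\<close> by simple functions, controlled by Young's
  inequality, then upgrades the convergence to all \<open>f \<in> L\<^sub>k\<close> (\<open>tendsto_pairing_Lk\<close>), hence to all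
  functions that generate the topology. Thus \<open>Q\<^sub>n\<close> tends to \<open>l\<close> along \<open>H\<close> in \<open>\<tau>\<^sub>F\<close>, and
  \<open>l \<in> \<Omega>\<close> because \<open>\<Omega>\<close> is closed.
\<close>

section \<open>Jordan decomposition of signed measures\<close>

lemma signed_measures_empty: "Q \<in> signed_measures M \<Longrightarrow> Q {} = 0"
  by (simp add: signed_measures_def)

lemma signed_measures_sums:
  "Q \<in> signed_measures M \<Longrightarrow> range A \<subseteq> sets M \<Longrightarrow> disjoint_family A \<Longrightarrow>
    (\<lambda>i::nat. Q (A i)) sums Q (\<Union>i. A i)"
  by (simp add: signed_measures_def)

lemma signed_measures_outside: "Q \<in> signed_measures M \<Longrightarrow> A \<notin> sets M \<Longrightarrow> Q A = 0"
  by (simp add: signed_measures_def)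

lemma signed_measures_Un:
  assumes Q: "Q \<in> signed_measures M" and "A \<in> sets M" "B \<in> sets M" "A \<inter> B = {}"
  shows "Q (A \<union> B) = Q A + Q B"
proof -
  have "(\<lambda>i. Q (binaryset A B i)) sums Q (\<Union>i. binaryset A B i)"
  proof (rule signed_measures_sums[OF Q])
    show "range (binaryset A B) \<subseteq> sets M"
      using assms by (auto simp: range_binaryset_eq)
    show "disjoint_family (binaryset A B)"
      using assms by (auto simp: disjoint_family_on_def binaryset_def)
  qed
  with binaryset_sums[of Q A B] signed_measures_empty[OF Q] show ?thesis
    by (metis UN_binaryset_eq sums_unique2)
qed

lemma signed_measures_Diff:
  assumes "Q \<in> signed_measures M" "A \<in> sets M" "B \<in> sets M" "B \<subseteq> A"
  shows "Q (A - B) = Q A - Q B"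
  using signed_measures_Un[of Q M B "A - B"] assms by (auto simp: Un_absorb1)

lemma signed_measures_uminus:
  "Q \<in> signed_measures M \<Longrightarrow> (\<lambda>A. - Q A) \<in> signed_measures M"
  by (auto simp: signed_measures_def intro: sums_minus)

lemma ennreal_sums_le:
  assumes "x sums s"
  shows "ennreal s \<le> (\<Sum>i. ennreal (x i))"
proof (rule LIMSEQ_le_const2)
  show "(\<lambda>n. ennreal (\<Sum>i<n. x i)) \<longlonglongrightarrow> ennreal s"
    using assms by (intro tendsto_ennrealI) (simp add: sums_def)
  have "ennreal (\<Sum>i<n. x i) \<le> (\<Sum>i. ennreal (x i))" for n
  proof -
    have "ennreal (\<Sum>i<n. x i) \<le> ennreal (\<Sum>i<n. max 0 (x i))"
      by (intro ennreal_leI sum_mono) auto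
    also have "\<dots> = (\<Sum>i<n. ennreal (x i))"
      by (subst sum_ennreal[symmetric]) (auto simp: max_def ennreal_neg simp del: sum_ennreal intro!: sum.cong)
    also have "\<dots> \<le> (\<Sum>i. ennreal (x i))"
      by (rule sum_le_suminf) auto
    finally show ?thesis .
  qed
  then show "\<exists>N. \<forall>n\<ge>N. ennreal (\<Sum>i<n. x i) \<le> (\<Sum>i. ennreal (x i))"
    by blast
qed

text \<open>The set function from which \<open>pos_variation\<close> is built, in a form that can be handled before it is
  known to be a measure.\<close>

definition upper_variation :: "'a measure \<Rightarrow> ('a set \<Rightarrow> real) \<Rightarrow> 'a set \<Rightarrow> ennreal" where
  "upper_variation M Q A = (SUP B\<in>{B\<in>sets M. B \<subseteq> A}. ennreal (Q B))"

lemma upper_variation_upper: "B \<in> sets M \<Longrightarrow> B \<subseteq> A \<Longrightarrow> ennreal (Q B) \<le> upper_variation M Q A"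
  unfolding upper_variation_def by (rule SUP_upper) auto

lemma upper_variation_mono: "A \<subseteq> B \<Longrightarrow> upper_variation M Q A \<le> upper_variation M Q B"
  unfolding upper_variation_def by (rule SUP_subset_mono) auto

text \<open>A negative value is truncated to 0, so either one of the two summands can be dropped or both are
  genuine values that add up on the disjoint union.\<close>

lemma upper_variation_superadditive:
  assumes Q: "Q \<in> signed_measures M" and "A \<inter> B = {}"
  shows "upper_variation M Q A + upper_variation M Q B \<le> upper_variation M Q (A \<union> B)"
proof -
  have le: "ennreal (Q C) + ennreal (Q D) \<le> upper_variation M Q (A \<union> B)"
    if "C \<in> sets M" "C \<subseteq> A" "D \<in> sets M" "D \<subseteq> B" for C D
  proof (cases "Q C \<ge> 0 \<and> Q D \<ge> 0")
    case True
    have "C \<inter> D = {}" using that assms(2) by auto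
    with True that have "ennreal (Q C) + ennreal (Q D) = ennreal (Q (C \<union> D))"
      by (subst signed_measures_Un[OF Q]) auto
    also have "\<dots> \<le> upper_variation M Q (A \<union> B)"
      using that by (intro upper_variation_upper) auto
    finally show ?thesis .
  next
    case False
    then have "ennreal (Q C) = 0 \<or> ennreal (Q D) = 0"
      by (auto simp: ennreal_neg)
    moreover have "ennreal (Q C) \<le> upper_variation M Q (A \<union> B)"
      "ennreal (Q D) \<le> upper_variation M Q (A \<union> B)"
      using that by (auto intro!: upper_variation_upper)
    ultimately show ?thesis by auto
  qed
  have ne: "{B\<in>sets M. B \<subseteq> A} \<noteq> {}" for A by auto
  have "upper_variation M Q A + upper_variation M Q B =
      (SUP C\<in>{B\<in>sets M. B \<subseteq> A}. SUP D\<in>{D\<in>sets M. D \<subseteq> B}. ennreal (Q C) + ennreal (Q D))"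
    unfolding upper_variation_def
    by (simp add: ennreal_SUP_add_left[OF ne, symmetric] ennreal_SUP_add_right[OF ne]) (rule SUP_commute)
  also have "\<dots> \<le> upper_variation M Q (A \<union> B)"
    by (intro SUP_least) (auto intro: le)
  finally show ?thesis .
qed

text \<open>One inequality passes from finite superadditivity to the limit. For the other, a set \<open>B\<close> inside the
  union is cut into the pieces \<open>B \<inter> A i\<close>, on which countable additivity of \<open>Q\<close> itself applies.\<close>

lemma upper_variation_countably_additive:
  assumes Q: "Q \<in> signed_measures M"
  shows "countably_additive (sets M) (upper_variation M Q)"
proof (rule countably_additiveI)
  fix A :: "nat \<Rightarrow> 'a set"
  assume A: "range A \<subseteq> sets M" and disj: "disjoint_family A"
  have fin: "(\<Sum>i<n. upper_variation M Q (A i)) \<le> upper_variation M Q (\<Union>i<n. A i)" for n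
  proof (induction n)
    case (Suc n)
    have "A i \<inter> A n = {}" if "i < n" for i
      using disj that by (intro disjoint_family_onD[of A UNIV]) auto
    then have "(\<Union>i<n. A i) \<inter> A n = {}"
      by blast
    from upper_variation_superadditive[OF Q this] Suc show ?case
      by (simp add: lessThan_Suc Un_commute add.commute) (meson add_left_mono order_trans)
  qed simp
  have "(\<Sum>i. upper_variation M Q (A i)) \<le> upper_variation M Q (\<Union>i. A i)"
  proof (rule suminf_le_const)
    fix n show "(\<Sum>i<n. upper_variation M Q (A i)) \<le> upper_variation M Q (\<Union>i. A i)"
      by (rule order_trans[OF fin]) (auto intro: upper_variation_mono)
  qed auto
  moreover have "upper_variation M Q (\<Union>i. A i) \<le> (\<Sum>i. upper_variation M Q (A i))"
    unfolding upper_variation_def[of M Q "\<Union>i. A i"]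
  proof (rule SUP_least, clarify)
    fix B assume B: "B \<in> sets M" "B \<subseteq> (\<Union>i. A i)"
    have "(\<lambda>i. Q (B \<inter> A i)) sums Q (\<Union>i. B \<inter> A i)"
    proof (rule signed_measures_sums[OF Q])
      show "range (\<lambda>i. B \<inter> A i) \<subseteq> sets M" using A B by auto
      show "disjoint_family (\<lambda>i. B \<inter> A i)"
        by (rule disjoint_family_on_bisimulation[OF disj]) auto
    qed
    also have "(\<Union>i. B \<inter> A i) = B" using B by auto
    finally have "ennreal (Q B) \<le> (\<Sum>i. ennreal (Q (B \<inter> A i)))"
      by (rule ennreal_sums_le)
    also have "\<dots> \<le> (\<Sum>i. upper_variation M Q (A i))"
      using A B by (intro suminf_le upper_variation_upper) auto
    finally show "ennreal (Q B) \<le> (\<Sum>i. upper_variation M Q (A i))" .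
  qed
  ultimately show "(\<Sum>i. upper_variation M Q (A i)) = upper_variation M Q (\<Union>i. A i)"
    by (rule antisym)
qed

lemma pos_variation_eq: "pos_variation M Q = measure_of (space M) (sets M) (upper_variation M Q)"
  unfolding pos_variation_def upper_variation_def ..

lemma sets_pos_variation [simp]: "sets (pos_variation M Q) = sets M"
  by (simp add: pos_variation_def)

lemma space_pos_variation [simp]: "space (pos_variation M Q) = space M"
  by (simp add: pos_variation_def)

lemma emeasure_pos_variation:
  assumes Q: "Q \<in> signed_measures M" and A: "A \<in> sets M"
  shows "emeasure (pos_variation M Q) A = upper_variation M Q A"
  unfolding pos_variation_eq
proof (rule emeasure_measure_of_sigma)
  show "positive (sets M) (upper_variation M Q)"
    by (auto simp: positive_def upper_variation_def signed_measures_empty[OF Q])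
qed (use sets.sigma_algebra_axioms A upper_variation_countably_additive[OF Q] in auto)

text \<open>If \<open>E\<close> has infinite upper variation, it has a subset \<open>B\<close> on which \<open>Q\<close> exceeds
  \<open>1 + \<bar>Q E\<bar>\<close>; then \<open>Q\<close> is larger than 1 in modulus on both \<open>B\<close> and \<open>E - B\<close>, and one of the
  two still has infinite upper variation. Keeping that one and repeating produces infinitely many
  disjoint sets on which \<open>Q\<close> is larger than 1 in modulus, against the convergence of the series
  of their values.\<close>

lemma upper_variation_finite:
  assumes Q: "Q \<in> signed_measures M"
  shows "upper_variation M Q (space M) < \<infinity>"
proof (rule ccontr)
  let ?inf = "\<lambda>E. E \<in> sets M \<and> upper_variation M Q E = \<infinity>"
  assume "\<not> ?thesis"
  then have start: "?inf (space M)" by (auto simp: less_top[symmetric])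
  have step: "\<exists>E'. ?inf E' \<and> E' \<subseteq> E \<and> \<bar>Q (E - E')\<bar> > 1" if E: "?inf E" for E
  proof -
    have "ennreal (1 + \<bar>Q E\<bar>) < (SUP B\<in>{B\<in>sets M. B \<subseteq> E}. ennreal (Q B))"
      using E unfolding upper_variation_def by (metis ennreal_less_top infinity_ennreal_def)
    then obtain B where B: "B \<in> sets M" "B \<subseteq> E" "ennreal (1 + \<bar>Q E\<bar>) < ennreal (Q B)"
      by (auto simp: less_SUP_iff)
    have QB: "1 + \<bar>Q E\<bar> < Q B"
      using B(3) by (subst (asm) ennreal_less_iff) auto
    have QD: "Q (E - B) = Q E - Q B"
      using signed_measures_Diff[OF Q _ B(1,2)] E by auto
    let ?\<mu> = "pos_variation M Q"
    have "emeasure ?\<mu> E = emeasure ?\<mu> B + emeasure ?\<mu> (E - B)"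
      using B E by (subst plus_emeasure) (auto simp: Un_absorb1)
    moreover have "E - B \<in> sets M" using B E by blast
    ultimately have "upper_variation M Q B + upper_variation M Q (E - B) = \<top>"
      using B(1) E by (simp only: emeasure_pos_variation[OF Q] infinity_ennreal_def)
    then have "upper_variation M Q B = \<infinity> \<or> upper_variation M Q (E - B) = \<infinity>"
      by (simp only: ennreal_add_eq_top infinity_ennreal_def)
    moreover have "\<bar>Q (E - B)\<bar> > 1" "\<bar>Q (E - (E - B))\<bar> > 1"
      using QB QD B(2) by (auto simp: double_diff)
    ultimately show ?thesis using B E
      by (elim disjE) (blast intro: exI[of _ B], blast intro: exI[of _ "E - B"])
  qed
  obtain E where E: "\<And>n::nat. ?inf (E n)" "\<And>n. E (Suc n) \<subseteq> E n" "\<And>n. \<bar>Q (E n - E (Suc n))\<bar> > 1"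
    using dependent_nat_choice[of "\<lambda>_. ?inf" "\<lambda>_ E E'. E' \<subseteq> E \<and> \<bar>Q (E - E')\<bar> > 1"] start step
    by (metis (no_types, lifting))
  have anti: "E m \<subseteq> E n" if "n \<le> m" for n m
    using E(2) that by (rule lift_Suc_antimono_le)
  have "disjoint_family (\<lambda>n. E n - E (Suc n))"
    unfolding disjoint_family_on_def
  proof safe
    fix m n x assume "m \<noteq> n" "x \<in> E m" "x \<in> E n" "x \<notin> E (Suc m)" "x \<notin> E (Suc n)"
    then show "x \<in> {}"
      using anti[of "Suc m" n] anti[of "Suc n" m] by (cases m n rule: linorder_cases) auto
  qed
  then have "(\<lambda>n. Q (E n - E (Suc n))) sums Q (\<Union>n. E n - E (Suc n))"
    using E(1) by (intro signed_measures_sums[OF Q]) auto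
  then have "(\<lambda>n. Q (E n - E (Suc n))) \<longlonglongrightarrow> 0"
    by (auto intro: summable_LIMSEQ_zero sums_summable)
  then have "\<forall>\<^sub>F n in sequentially. \<bar>Q (E n - E (Suc n))\<bar> < 1"
    by (auto dest!: tendstoD[of _ _ _ 1] simp: dist_real_def)
  then show False using E(3) by (auto simp: eventually_sequentially) (meson not_less_iff_gr_or_eq order_refl)
qed

lemma finite_measure_pos_variation:
  "Q \<in> signed_measures M \<Longrightarrow> finite_measure (pos_variation M Q)"
  using upper_variation_finite[of Q M]
  by (intro finite_measureI) (auto simp: emeasure_pos_variation less_top)

text \<open>For \<open>B \<subseteq> A\<close> one has \<open>Q B = Q A - Q (A - B)\<close>; taking suprema over \<open>B\<close> gives one
  inequality, and the same inequality for \<open>-Q\<close> gives the other. Finiteness of the variations is what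
  makes the differences of real numbers meaningful.\<close>

lemma Jordan_decomposition:
  assumes Q: "Q \<in> signed_measures M" and A: "A \<in> sets M"
  shows "Q A = measure (pos_variation M Q) A - measure (neg_variation M Q) A"
proof -
  note Q' = signed_measures_uminus[OF Q]
  interpret p: finite_measure "pos_variation M Q" by (rule finite_measure_pos_variation[OF Q])
  interpret n: finite_measure "neg_variation M Q"
    unfolding neg_variation_def by (rule finite_measure_pos_variation[OF Q'])
  \<comment> \<open>Stated for arbitrary \<open>R\<close>, so that it can be used for \<open>Q\<close> and for \<open>-Q\<close>.\<close>
  have le: "measure (pos_variation M R) A \<le> R A + measure (pos_variation M (\<lambda>A. - R A)) A"
    if R: "R \<in> signed_measures M" for R
  proof -
    interpret p: finite_measure "pos_variation M R" by (rule finite_measure_pos_variation[OF R])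
    interpret n: finite_measure "pos_variation M (\<lambda>A. - R A)"
      by (rule finite_measure_pos_variation[OF signed_measures_uminus[OF R]])
    have "- R B \<le> measure (pos_variation M (\<lambda>A. - R A)) A" if B: "B \<in> sets M" "B \<subseteq> A" for B
      using upper_variation_upper[OF B, of "\<lambda>A. - R A"]
        emeasure_pos_variation[OF signed_measures_uminus[OF R] A]
      by (simp add: n.emeasure_eq_measure flip: ennreal_le_iff)
    note n_ge = this
    have "R B \<le> R A + measure (pos_variation M (\<lambda>A. - R A)) A" if B: "B \<in> sets M" "B \<subseteq> A" for B
      using n_ge[of "A - B"] signed_measures_Diff[OF R A B] A B by auto
    then have "upper_variation M R A \<le> ennreal (R A + measure (pos_variation M (\<lambda>A. - R A)) A)"
      unfolding upper_variation_def by (auto intro!: SUP_least ennreal_leI)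
    then have "ennreal (measure (pos_variation M R) A)
        \<le> ennreal (R A + measure (pos_variation M (\<lambda>A. - R A)) A)"
      by (simp add: emeasure_pos_variation[OF R A, symmetric] p.emeasure_eq_measure)
    moreover have "0 \<le> R A + measure (pos_variation M (\<lambda>A. - R A)) A"
      using n_ge[of A] A by auto
    ultimately show ?thesis by simp
  qed
  show ?thesis
    using le[OF Q] le[OF Q'] by (simp add: neg_variation_def)
qed

lemma pos_variation_has_density:
  assumes "finite_measure P" and Q: "Q \<in> signed_measures P" and ac: "signed_ac P Q"
  obtains h where "integrable P h"
    "\<And>A. A \<in> sets P \<Longrightarrow> measure (pos_variation P Q) A = (LINT x:A|P. h x)"
proof -
  interpret finite_measure P by fact
  let ?N = "pos_variation P Q"
  interpret N: finite_measure ?N by (rule finite_measure_pos_variation[OF Q])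
  have ac': "absolutely_continuous P ?N"
    unfolding absolutely_continuous_def
  proof
    fix A assume "A \<in> null_sets P"
    then have A: "A \<in> sets P" "emeasure P A = 0" by auto
    have "Q B = 0" if "B \<in> sets P" "B \<subseteq> A" for B
      using ac that A emeasure_mono[of B A P] by (auto simp: signed_ac_def)
    then have "upper_variation P Q A \<le> 0"
      unfolding upper_variation_def by (intro SUP_least) auto
    then show "A \<in> null_sets ?N"
      using A by (auto simp: emeasure_pos_variation[OF Q] null_sets_def)
  qed
  obtain f where f: "f \<in> borel_measurable P" "density P f = ?N"
    using Radon_Nikodym_finite_measure[OF N.finite_measure_axioms _ ac'] by auto
  have em: "emeasure ?N A = (\<integral>\<^sup>+x. f x * indicator A x \<partial>P)" if "A \<in> sets P" for A
    using that f by (metis emeasure_density)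
  have "(\<integral>\<^sup>+x. f x \<partial>P) = emeasure ?N (space P)"
    by (subst em) (auto intro!: nn_integral_cong)
  then have fin: "(\<integral>\<^sup>+x. f x \<partial>P) < \<infinity>"
    by (simp add: N.emeasure_eq_measure)
  have AE: "AE x in P. f x \<noteq> \<infinity>"
    using fin by (intro nn_integral_PInf_AE f) auto
  have eq: "(\<integral>\<^sup>+x. ennreal (enn2real (f x)) * indicator A x \<partial>P) = (\<integral>\<^sup>+x. f x * indicator A x \<partial>P)" for A
    using AE by (intro nn_integral_cong_AE) (auto simp: less_top)
  have int: "integrable P (\<lambda>x. enn2real (f x))"
    using fin eq[of UNIV] f(1) by (intro integrableI_nonneg) auto
  have "measure ?N A = (LINT x:A|P. enn2real (f x))" if A: "A \<in> sets P" for A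
  proof -
    have "(LINT x:A|P. enn2real (f x)) = enn2real (\<integral>\<^sup>+x. ennreal (enn2real (f x)) * indicator A x \<partial>P)"
      unfolding set_lebesgue_integral_def using A f(1)
      by (subst integral_eq_nn_integral)
         (auto intro!: arg_cong[where f=enn2real] nn_integral_cong simp: indicator_def)
    also have "\<dots> = measure ?N A"
      by (simp only: eq em[OF A, symmetric] measure_def)
    finally show ?thesis ..
  qed
  with int that show ?thesis by blast
qed

section \<open>Densities of signed measures\<close>

text \<open>\<open>g\<close> is a density \<open>dQ/dP\<close>. Most facts below hold for any choice of density, so they are stated
  for this relation rather than for \<open>signed_RN_deriv\<close>.\<close>

definition signed_density :: "'a measure \<Rightarrow> ('a set \<Rightarrow> real) \<Rightarrow> ('a \<Rightarrow> real) \<Rightarrow> bool" where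
  "signed_density P Q g \<longleftrightarrow> Q \<in> signed_measures P \<and> integrable P g \<and>
     (\<forall>A\<in>sets P. Q A = (LINT x:A|P. g x))"

lemma signed_densityD:
  assumes "signed_density P Q g"
  shows "Q \<in> signed_measures P" "integrable P g" "A \<in> sets P \<Longrightarrow> Q A = (LINT x:A|P. g x)"
  using assms by (auto simp: signed_density_def)

text \<open>Both variations inherit absolute continuity from \<open>Q\<close>, so the Radon-Nikodym theorem for finite
  measures applies to each of them. This justifies the choice made in \<open>signed_RN_deriv\<close>.\<close>

theorem signed_Radon_Nikodym:
  assumes "finite_measure P" and Q: "Q \<in> signed_measures P" and ac: "signed_ac P Q"
  shows "signed_density P Q (signed_RN_deriv P Q)"
proof -
  have ac': "signed_ac P (\<lambda>A. - Q A)"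
    using ac by (simp add: signed_ac_def)
  obtain h where h: "integrable P h"
    "\<And>A. A \<in> sets P \<Longrightarrow> measure (pos_variation P Q) A = (LINT x:A|P. h x)"
    using pos_variation_has_density[OF assms] by blast
  obtain k where k: "integrable P k"
    "\<And>A. A \<in> sets P \<Longrightarrow> measure (neg_variation P Q) A = (LINT x:A|P. k x)"
    unfolding neg_variation_def
    using pos_variation_has_density[OF assms(1) signed_measures_uminus[OF Q] ac'] by blast
  have "Q A = (LINT x:A|P. h x - k x)" if A: "A \<in> sets P" for A
    using h k A integrable_mult_indicator[OF A h(1)] integrable_mult_indicator[OF A k(1)]
    by (subst set_integral_diff(2)) (auto simp: Jordan_decomposition[OF Q] set_integrable_def)
  then have "\<exists>g. integrable P g \<and> (\<forall>A\<in>sets P. Q A = (LINT x:A|P. g x))"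
    using h k by (intro exI[of _ "\<lambda>x. h x - k x"]) auto
  from someI_ex[OF this] show ?thesis
    using Q unfolding signed_RN_deriv_def signed_density_def by auto
qed

text \<open>The supremum in the upper variation of \<open>A\<close> is attained at the part of \<open>A\<close> where the density is
  nonnegative. Truncation by \<open>ennreal\<close> turns \<open>g\<close> into its positive part.\<close>

lemma pos_variation_of_density:
  assumes dens: "signed_density P Q g"
  shows "pos_variation P Q = density P (\<lambda>x. ennreal (g x))"
proof (rule measure_eqI)
  note Q = signed_densityD(1)[OF dens] and g = signed_densityD(2)[OF dens]
    and Qg = signed_densityD(3)[OF dens]
  fix A assume "A \<in> sets (pos_variation P Q)"
  then have A[measurable]: "A \<in> sets P" by simp
  have gm[measurable]: "g \<in> borel_measurable P" using g by auto
  have int: "(\<integral>\<^sup>+x. ennreal (g x) * indicator B x \<partial>P) = ennreal (LINT x:B|P. max 0 (g x))"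
    if B: "B \<in> sets P" for B
  proof -
    have "(\<integral>\<^sup>+x. ennreal (g x) * indicator B x \<partial>P) = (\<integral>\<^sup>+x. ennreal (indicator B x * max 0 (g x)) \<partial>P)"
      by (intro nn_integral_cong) (auto simp: indicator_def max_def ennreal_neg)
    also have "\<dots> = ennreal (LINT x|P. indicator B x * max 0 (g x))"
    proof (intro nn_integral_eq_integral)
      show "integrable P (\<lambda>x. indicator B x * max 0 (g x))"
        using B by (intro Bochner_Integration.integrable_bound[OF g]) (auto simp: indicator_def)
    qed auto
    finally show ?thesis by (simp add: set_lebesgue_integral_def)
  qed
  have "upper_variation P Q A = ennreal (LINT x:A|P. max 0 (g x))"
  proof (rule antisym)
    show "upper_variation P Q A \<le> ennreal (LINT x:A|P. max 0 (g x))"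
      unfolding upper_variation_def
    proof (rule SUP_least, clarify)
      fix B assume B: "B \<in> sets P" "B \<subseteq> A"
      have "Q B \<le> (LINT x:A|P. max 0 (g x))"
        unfolding Qg[OF B(1)] set_lebesgue_integral_def using g A B
        by (intro integral_mono integrable_mult_indicator) (auto simp: indicator_def)
      then show "ennreal (Q B) \<le> ennreal (LINT x:A|P. max 0 (g x))" by (rule ennreal_leI)
    qed
    have B: "{x\<in>A. g x \<ge> 0} \<in> sets P"
    proof -
      have "{x\<in>A. g x \<ge> 0} = A \<inter> {x\<in>space P. g x \<ge> 0}"
        using sets.sets_into_space[OF A] by auto
      then show ?thesis by simp
    qed
    have "(LINT x:A|P. max 0 (g x)) = Q {x\<in>A. g x \<ge> 0}"
      unfolding Qg[OF B] set_lebesgue_integral_def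
      by (intro Bochner_Integration.integral_cong) (auto simp: indicator_def)
    then show "ennreal (LINT x:A|P. max 0 (g x)) \<le> upper_variation P Q A"
      using B by (auto intro!: upper_variation_upper)
  qed
  then show "emeasure (pos_variation P Q) A = emeasure (density P (\<lambda>x. ennreal (g x))) A"
    by (simp add: emeasure_pos_variation[OF Q] emeasure_density int[OF A])
qed simp

lemma neg_variation_of_density:
  assumes dens: "signed_density P Q g"
  shows "neg_variation P Q = density P (\<lambda>x. ennreal (- g x))"
  unfolding neg_variation_def
  using dens by (intro pos_variation_of_density)
    (auto simp: signed_density_def set_lebesgue_integral_def signed_measures_uminus)

lemma nn_integral_total_variation:
  assumes dens: "signed_density P Q g" and f: "f \<in> borel_measurable P"
  shows "(\<integral>\<^sup>+x. f x \<partial>total_variation P Q) = (\<integral>\<^sup>+x. ennreal \<bar>g x\<bar> * f x \<partial>P)"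
proof -
  have [measurable]: "g \<in> borel_measurable P" using signed_densityD(2)[OF dens] by auto
  have "emeasure (pos_variation P Q) A + emeasure (neg_variation P Q) A
        = emeasure (density P (\<lambda>x. ennreal \<bar>g x\<bar>)) A" if [measurable]: "A \<in> sets P" for A
    unfolding pos_variation_of_density[OF dens] neg_variation_of_density[OF dens]
    by (simp add: emeasure_density flip: nn_integral_add)
       (auto intro!: nn_integral_cong simp: indicator_def abs_if ennreal_neg)
  then have "total_variation P Q = measure_of (space P) (sets P) (emeasure (density P (\<lambda>x. ennreal \<bar>g x\<bar>)))"
    unfolding total_variation_def
    by (intro measure_of_eq sets.space_closed) (simp add: sets.sigma_sets_eq)
  also have "\<dots> = density P (\<lambda>x. ennreal \<bar>g x\<bar>)"
    using measure_of_of_measure[of "density P (\<lambda>x. ennreal \<bar>g x\<bar>)"] by simp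
  finally show ?thesis using f by (simp add: nn_integral_density)
qed

lemma signed_integral_of_density:
  assumes dens: "signed_density P Q g" and f: "f \<in> borel_measurable P" and fg: "integrable P (\<lambda>x. f x * g x)"
  shows "signed_integral P Q f = (LINT x|P. f x * g x)"
proof -
  have gm[measurable]: "g \<in> borel_measurable P" using signed_densityD(2)[OF dens] by auto
  have trunc: "density P (\<lambda>x. ennreal (h x)) = density P (\<lambda>x. ennreal (max 0 (h x)))" for h
    by (rule arg_cong[where f="density P"]) (auto simp: max_def ennreal_neg)
  have i1: "integrable P (\<lambda>x. max 0 (g x) * f x)"
    by (rule Bochner_Integration.integrable_bound[OF fg])
       (use f in \<open>auto simp: abs_mult max_def mult.commute mult_nonpos_nonneg\<close>)
  have i2: "integrable P (\<lambda>x. max 0 (- g x) * f x)"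
    by (rule Bochner_Integration.integrable_bound[OF fg])
       (use f in \<open>auto simp: abs_mult max_def mult.commute mult_nonpos_nonneg\<close>)
  have "signed_integral P Q f = (LINT x|P. max 0 (g x) * f x) - (LINT x|P. max 0 (- g x) * f x)"
    unfolding signed_integral_def pos_variation_of_density[OF dens] neg_variation_of_density[OF dens]
    unfolding trunc[of g] trunc[of "\<lambda>x. - g x"]
    using f by (subst (1 2) integral_real_density) auto
  also have "\<dots> = (LINT x|P. max 0 (g x) * f x - max 0 (- g x) * f x)"
    using i1 i2 by simp
  also have "\<dots> = (LINT x|P. f x * g x)"
    by (intro Bochner_Integration.integral_cong) (auto simp: max_def)
  finally show ?thesis .
qed

section \<open>Divergence functions as suprema of affine functions\<close>

lemma divergence_function_convex:
  assumes \<phi>: "divergence_function \<phi> a b" and t: "0 \<le> t" "t \<le> 1"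
  shows "\<phi> ((1 - t) * x + t * y) \<le> ennreal (1 - t) * \<phi> x + ennreal t * \<phi> y"
  using \<phi> t unfolding divergence_function_def by auto

lemma divergence_function_finite:
  "divergence_function \<phi> a b \<Longrightarrow> a < ereal x \<Longrightarrow> ereal x < b \<Longrightarrow> \<phi> x < \<infinity>"
  unfolding divergence_function_def by auto

lemma divergence_function_infinite:
  "divergence_function \<phi> a b \<Longrightarrow> ereal x < a \<or> b < ereal x \<Longrightarrow> \<phi> x = \<infinity>"
  unfolding divergence_function_def
  by (metis (mono_tags, lifting) infinity_ennreal_def mem_Collect_eq not_le subsetD top.not_eq_extremum)

text \<open>Inside the domain \<open>\<phi>\<close> is a finite convex function of one variable and has a tangent line. Outside
  the domain \<open>\<phi>\<close> is infinite, so the tangent stays below \<open>\<phi>\<close> on the whole line.\<close>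

lemma divergence_function_subgradient:
  assumes \<phi>: "divergence_function \<phi> a b" and z: "a < ereal z" "ereal z < b"
  obtains s where "\<And>y. ennreal (enn2real (\<phi> z) + s * (y - z)) \<le> \<phi> y"
proof -
  let ?I = "{x. \<phi> x < \<infinity>}" and ?f = "\<lambda>x. enn2real (\<phi> x)"
  have fin: "ennreal (?f x) = \<phi> x" if "x \<in> ?I" for x
    using that by (auto simp: less_top)
  have ineq: "\<phi> ((1 - t) * x + t * y) \<le> ennreal ((1 - t) * ?f x + t * ?f y)"
    if "0 \<le> t" "t \<le> 1" "x \<in> ?I" "y \<in> ?I" for t x y
  proof -
    have "\<phi> ((1 - t) * x + t * y) \<le> ennreal (1 - t) * ennreal (?f x) + ennreal t * ennreal (?f y)"
      using divergence_function_convex[OF \<phi> that(1,2)] that by (simp add: fin)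
    also have "\<dots> = ennreal ((1 - t) * ?f x + t * ?f y)"
      using that by (simp add: ennreal_mult)
    finally show ?thesis .
  qed
  have "convex_on ?I ?f"
  proof (rule convex_onI)
    show "convex ?I"
      unfolding convex_alt using le_less_trans[OF ineq ennreal_less_top] by simp
  next
    fix t x y :: real
    assume t: "0 < t" "t < 1" and xy: "x \<in> ?I" "y \<in> ?I"
    have "?f ((1 - t) *\<^sub>R x + t *\<^sub>R y) \<le> enn2real (ennreal ((1 - t) * ?f x + t * ?f y))"
      using ineq[of t x y] t xy by (intro enn2real_mono) auto
    also have "\<dots> = (1 - t) * ?f x + t * ?f y"
      using t by (intro enn2real_ennreal) auto
    finally show "?f ((1 - t) *\<^sub>R x + t *\<^sub>R y) \<le> (1 - t) * ?f x + t * ?f y" .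
  qed
  moreover have "z \<in> interior ?I"
  proof (rule interiorI)
    show "open {x. a < ereal x \<and> ereal x < b}"
      by (intro open_Collect_conj open_Collect_less continuous_intros)
  qed (use z divergence_function_finite[OF \<phi>] in auto)
  ultimately obtain s where s: "\<And>y. y \<in> ?I \<Longrightarrow> ?f z + s * (y - z) \<le> ?f y"
    using convex_le_Inf_differential[of ?I ?f z] by blast
  have "ennreal (?f z + s * (y - z)) \<le> \<phi> y" for y
  proof (cases "y \<in> ?I")
    case True
    then show ?thesis using ennreal_leI[OF s[OF True]] fin[OF True] by simp
  next
    case False
    then have "\<phi> y = top" by (simp add: less_top[symmetric])
    then show ?thesis by simp
  qed
  with that show ?thesis by blast
qed

text \<open>At an interior point of the domain a tangent at \<open>x\<close> itself works. At an endpoint \<open>x\<close> of the domain,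
  \<open>\<phi>\<close> need not have a tangent; a tangent at a point \<open>z\<close> between 1 and \<open>x\<close> does the job, because
  closedness brings \<open>\<phi> z\<close> above \<open>c\<close> for \<open>z\<close> close to \<open>x\<close>, and beyond \<open>z\<close> the tangent
  is at least as large as at \<open>z\<close>, as it is nonpositive at 1 and
  nonnegative at \<open>z\<close>. Strictly outside the domain, a steep line
  that vanishes at the endpoint works, since \<open>\<phi>\<close> is nonnegative.\<close>

lemma divergence_function_affine_minorant:
  assumes \<phi>: "divergence_function \<phi> a b" and c: "0 \<le> c" "ennreal c < \<phi> x"
  obtains \<alpha> \<beta> where "\<And>y. ennreal (\<alpha> * y + \<beta>) \<le> \<phi> y" "c < \<alpha> * x + \<beta>"
proof -
  note minorant = that
  have one: "\<phi> 1 = 0" "a < 1" "1 < b"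
    using \<phi> by (auto simp: divergence_function_def)
  \<comment> \<open>The first side condition says that \<open>z\<close> lies between 1 and \<open>x\<close>.\<close>
  have tangent: thesis if z: "a < ereal z" "ereal z < b" "ennreal c < \<phi> z" and side: "0 \<le> (x - z) * (z - 1)" "z \<noteq> 1 \<or> x = z" for z
  proof -
    obtain s where s: "\<And>y. ennreal (enn2real (\<phi> z) + s * (y - z)) \<le> \<phi> y"
      using divergence_function_subgradient[OF \<phi> z(1,2)] by blast
    have "enn2real (\<phi> z) + s * (1 - z) \<le> 0"
      using s[of 1] by (simp add: one ennreal_eq_0_iff)
    then have "0 \<le> s * (z - 1)"
      using enn2real_nonneg[of "\<phi> z"] unfolding right_diff_distrib by linarith
    then have sx: "0 \<le> s * (x - z)"
      using side by (auto simp: zero_le_mult_iff)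
    have "ennreal c < ennreal (enn2real (\<phi> z))"
      using z divergence_function_finite[OF \<phi> z(1,2)] by (auto simp: less_top)
    then have "c < enn2real (\<phi> z)"
      using c by (simp add: ennreal_less_iff)
    then show thesis
      using sx s by (intro minorant[of s "enn2real (\<phi> z) - s * z"]) (auto simp: algebra_simps)
  qed
  have outside: thesis if N: "\<And>y. \<phi> y < \<infinity> \<Longrightarrow> N * (y - e) \<le> 0" "c < N * (x - e)" for N e
  proof (rule minorant[of N "- N * e"])
    fix y show "ennreal (N * y + - N * e) \<le> \<phi> y"
      using N(1)[of y] by (cases "\<phi> y < \<infinity>") (auto simp: less_top[symmetric] right_diff_distrib ennreal_neg)
  qed (use N(2) in \<open>simp add: right_diff_distrib\<close>)
  consider "a < ereal x" "ereal x < b" | "b = ereal x" | "a = ereal x"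
    | \<beta> where "b = ereal \<beta>" "\<beta> < x" | \<alpha> where "a = ereal \<alpha>" "x < \<alpha>"
    using one less_linear[of "ereal x" a] less_linear[of "ereal x" b]
    by (cases a; cases b) auto
  then show thesis
  proof cases
    case 1
    then show thesis using c by (intro tangent[of x]) auto
  next
    case 2
    have "\<forall>\<^sub>F z in at_left x. ennreal c < \<phi> z"
      using \<phi> c 2 by (intro order_tendstoD(1)[of \<phi> "\<phi> x"]) (auto simp: divergence_function_def)
    moreover have "\<forall>\<^sub>F z in at_left x. 1 < z \<and> z < x"
      using one 2 eventually_at_left_real[of 1 x] by simp
    ultimately have "\<forall>\<^sub>F z in at_left x. ennreal c < \<phi> z \<and> 1 < z \<and> z < x"
      by (rule eventually_conj)
    then obtain z where z: "ennreal c < \<phi> z" "1 < z" "z < x"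
      using eventually_happens'[OF trivial_limit_at_left_real] by blast
    with one 2 have "a < ereal z" by (cases a) auto
    with one 2 z show thesis
      by (intro tangent[of z]) auto
  next
    case 3
    have "\<forall>\<^sub>F z in at_right x. ennreal c < \<phi> z"
      using \<phi> c 3 by (intro order_tendstoD(1)[of \<phi> "\<phi> x"]) (auto simp: divergence_function_def)
    moreover have "\<forall>\<^sub>F z in at_right x. x < z \<and> z < 1"
      using one 3 eventually_at_right_real[of x 1] by simp
    ultimately have "\<forall>\<^sub>F z in at_right x. ennreal c < \<phi> z \<and> x < z \<and> z < 1"
      by (rule eventually_conj)
    then obtain z where z: "ennreal c < \<phi> z" "x < z" "z < 1"
      using eventually_happens'[OF trivial_limit_at_right_real] by blast
    with one 3 have "ereal z < b" by (cases b) auto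
    with one 3 z show thesis
      by (intro tangent[of z]) (auto simp: mult_nonpos_nonpos)
  next
    case (4 \<beta>)
    show thesis
    proof (rule outside)
      show "(c + 1) / (x - \<beta>) * (y - \<beta>) \<le> 0" if "\<phi> y < \<infinity>" for y
        using that divergence_function_infinite[OF \<phi>, of y] c 4
        by (intro mult_nonneg_nonpos divide_nonneg_nonneg) (auto simp: not_less[symmetric])
    qed (use c 4 in auto)
  next
    case (5 \<alpha>)
    show thesis
    proof (rule outside)
      show "(c + 1) / (x - \<alpha>) * (y - \<alpha>) \<le> 0" if "\<phi> y < \<infinity>" for y
        using that divergence_function_infinite[OF \<phi>, of y] c 5
        by (intro mult_nonpos_nonneg divide_nonneg_nonpos) (auto simp: not_less[symmetric])
    qed (use c 5 in auto)
  qed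
qed

text \<open>The affine minorants form a subset of the plane of coefficients, which is separable; a dense
  sequence of minorants suffices because the value at \<open>x\<close> is continuous in the coefficients.\<close>

lemma divergence_function_SUP_affine:
  assumes \<phi>: "divergence_function \<phi> a b"
  obtains \<alpha> \<beta> :: "nat \<Rightarrow> real" where "\<And>x. \<phi> x = (SUP i. ennreal (\<alpha> i * x + \<beta> i))"
proof -
  let ?M = "{p. \<forall>y. ennreal (fst p * y + snd p) \<le> \<phi> y}"
  obtain D where D: "countable D" "D \<subseteq> ?M" "?M \<subseteq> closure D"
    by (rule separable)
  have *: "\<exists>p\<in>D. c < fst p * x + snd p" if "0 \<le> c" "ennreal c < \<phi> x" for c x
  proof -
    obtain \<alpha> \<beta> where \<alpha>\<beta>: "\<And>y. ennreal (\<alpha> * y + \<beta>) \<le> \<phi> y" "c < \<alpha> * x + \<beta>"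
      using divergence_function_affine_minorant[OF \<phi> \<open>0 \<le> c\<close> \<open>ennreal c < \<phi> x\<close>] by blast
    then have "(\<alpha>, \<beta>) \<in> closure D" using D(3) by auto
    moreover have "open {p. c < fst p * x + snd p}"
      by (intro open_Collect_less continuous_intros)
    ultimately show ?thesis
      using \<alpha>\<beta>(2) unfolding closure_iff_nhds_not_empty by fastforce
  qed
  have "(0, 0) \<in> closure D" using D(3) by (auto simp: subset_iff)
  then have ne: "D \<noteq> {}" by auto
  have "\<phi> x = (SUP p\<in>D. ennreal (fst p * x + snd p))" for x
  proof (rule antisym)
    show "\<phi> x \<le> (SUP p\<in>D. ennreal (fst p * x + snd p))"
    proof (rule dense_le)
      fix y assume y: "y < \<phi> x"
      then have "y \<noteq> top" by auto
      then obtain c where c: "y = ennreal c" "0 \<le> c" by (cases y) auto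
      then obtain p where p: "p \<in> D" "c < fst p * x + snd p" using * y by blast
      then have "y \<le> ennreal (fst p * x + snd p)" using c by (auto intro: ennreal_leI)
      also have "\<dots> \<le> (SUP p\<in>D. ennreal (fst p * x + snd p))" using p by (intro SUP_upper)
      finally show "y \<le> (SUP p\<in>D. ennreal (fst p * x + snd p))" .
    qed
  qed (use D in \<open>auto intro!: SUP_least\<close>)
  also have "(SUP p\<in>D. ennreal (fst p * x + snd p)) =
      (SUP i. ennreal (fst (from_nat_into D i) * x + snd (from_nat_into D i)))" for x
    by (subst range_from_nat_into[OF ne D(1), symmetric]) (simp add: image_image)
  finally show thesis by (rule that)
qed

text \<open>Any real \<open>c\<close> strictly between 0 and \<open>L\<close> works far from the origin, including the case where
  \<open>L\<close> is infinite; the constant \<open>R\<close> absorbs the values near the origin.\<close>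

lemma powr_growth:
  fixes \<phi> :: "real \<Rightarrow> ennreal"
  assumes L: "0 < L" "((\<lambda>x. \<phi> x / ennreal (\<bar>x\<bar> powr r)) \<longlongrightarrow> L) at_infinity" and r: "0 < r"
  obtains c R where "0 < c" "0 \<le> R" "\<And>x. ennreal (c * \<bar>x\<bar> powr r) \<le> \<phi> x + ennreal R"
proof -
  obtain c where c: "0 < ennreal c" "ennreal c < L"
    using dense[OF L(1)] by (metis ennreal_cases top.extremum_strict)
  then have c0: "0 < c" by simp
  obtain B where B: "\<And>x. B \<le> \<bar>x\<bar> \<Longrightarrow> ennreal c < \<phi> x / ennreal (\<bar>x\<bar> powr r)"
    using order_tendstoD(1)[OF L(2) c(2)] unfolding eventually_at_infinity by auto
  let ?B = "max B 1"
  have "ennreal (c * \<bar>x\<bar> powr r) \<le> \<phi> x + ennreal (c * ?B powr r)" for x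
  proof (cases "?B \<le> \<bar>x\<bar>")
    case True
    then have pos: "0 < \<bar>x\<bar> powr r" by auto
    have "ennreal (c * \<bar>x\<bar> powr r) = ennreal c * ennreal (\<bar>x\<bar> powr r)"
      using c0 by (simp add: ennreal_mult)
    also have "\<dots> \<le> \<phi> x / ennreal (\<bar>x\<bar> powr r) * ennreal (\<bar>x\<bar> powr r)"
      using B[of x] True by (intro mult_right_mono) auto
    also have "\<dots> = \<phi> x"
      using pos by (simp add: ennreal_divide_times ennreal_mult_divide_eq)
    also have "\<dots> \<le> \<phi> x + ennreal (c * ?B powr r)" by simp
    finally show ?thesis .
  next
    case False
    then have "ennreal (c * \<bar>x\<bar> powr r) \<le> ennreal (c * ?B powr r)"
      using c0 r by (intro ennreal_leI mult_left_mono powr_mono2) auto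
    also have "\<dots> \<le> \<phi> x + ennreal (c * ?B powr r)" by simp
    finally show ?thesis .
  qed
  with c0 that show thesis by (metis less_eq_real_def mult_nonneg_nonneg powr_ge_zero)
qed

section \<open>Lower semicontinuity of the divergence under setwise convergence\<close>

lemma ennreal_integral_le:
  assumes h: "integrable M h"
  shows "ennreal (LINT x|M. h x) \<le> (\<integral>\<^sup>+x. ennreal (h x) \<partial>M)"
proof -
  have "ennreal (LINT x|M. h x) \<le> ennreal (LINT x|M. max 0 (h x))"
    using h by (intro ennreal_leI integral_mono) auto
  also have "\<dots> = (\<integral>\<^sup>+x. ennreal (max 0 (h x)) \<partial>M)"
    using h by (intro nn_integral_eq_integral[symmetric]) auto
  also have "\<dots> = (\<integral>\<^sup>+x. ennreal (h x) \<partial>M)"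
    by (intro nn_integral_cong) (simp add: max_def ennreal_neg)
  finally show ?thesis .
qed

text \<open>The positive part of an affine function of \<open>h\<close> is integrated by restricting to the set where this
  function is nonnegative. That set does not depend on \<open>n\<close>, so the corresponding integrals for
  \<open>g n\<close> converge.\<close>

lemma affine_minorant_lower_semicontinuous:
  fixes g :: "nat \<Rightarrow> 'a \<Rightarrow> real"
  assumes "finite_measure P" and g: "\<And>n. integrable P (g n)" and h: "integrable P h"
    and lim: "\<forall>A\<in>sets P. ((\<lambda>n. LINT x:A|P. g n x) \<longlongrightarrow> (LINT x:A|P. h x)) H"
    and minorant: "\<And>y. ennreal (\<alpha> * y + \<beta>) \<le> \<phi> y" and A: "A \<in> sets P" and e: "0 < e"
  shows "\<forall>\<^sub>F n in H. (\<integral>\<^sup>+x. ennreal (\<alpha> * h x + \<beta>) * indicator A x \<partial>P)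
     \<le> (\<integral>\<^sup>+x. \<phi> (g n x) * indicator A x \<partial>P) + ennreal e"
proof -
  interpret finite_measure P by fact
  let ?B = "A \<inter> {x\<in>space P. 0 \<le> \<alpha> * h x + \<beta>}"
  have [measurable]: "h \<in> borel_measurable P" using h by auto
  have B: "?B \<in> sets P" using A by measurable
  have int: "integrable P (\<lambda>x. indicator ?B x * (\<alpha> * u x + \<beta>))"
    and eq: "(LINT x|P. indicator ?B x * (\<alpha> * u x + \<beta>)) = \<alpha> * (LINT x:?B|P. u x) + \<beta> * measure P ?B"
    if u: "integrable P u" for u
  proof -
    have i: "integrable P (\<lambda>x. indicator ?B x * u x)" "integrable P (indicator ?B :: _ \<Rightarrow> real)"
      using integrable_mult_indicator[OF B u] B by (auto simp: less_top[symmetric])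
    have *: "indicator ?B x * (\<alpha> * u x + \<beta>) = \<alpha> * (indicator ?B x * u x) + \<beta> * indicator ?B x" for x
      by (simp add: algebra_simps)
    show "integrable P (\<lambda>x. indicator ?B x * (\<alpha> * u x + \<beta>))"
      unfolding * using i by simp
    show "(LINT x|P. indicator ?B x * (\<alpha> * u x + \<beta>)) = \<alpha> * (LINT x:?B|P. u x) + \<beta> * measure P ?B"
      unfolding * using i B by (simp add: set_lebesgue_integral_def)
  qed
  have "(\<integral>\<^sup>+x. ennreal (\<alpha> * h x + \<beta>) * indicator A x \<partial>P)
      = (\<integral>\<^sup>+x. ennreal (indicator ?B x * (\<alpha> * h x + \<beta>)) \<partial>P)"
    by (intro nn_integral_cong) (auto simp: indicator_def ennreal_neg)
  also have "\<dots> = ennreal (\<alpha> * (LINT x:?B|P. h x) + \<beta> * measure P ?B)"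
    using int[OF h] unfolding eq[OF h, symmetric]
    by (intro nn_integral_eq_integral) (auto simp: indicator_def)
  finally have left: "(\<integral>\<^sup>+x. ennreal (\<alpha> * h x + \<beta>) * indicator A x \<partial>P)
      = ennreal (\<alpha> * (LINT x:?B|P. h x) + \<beta> * measure P ?B)" .
  have right: "ennreal (\<alpha> * (LINT x:?B|P. g n x) + \<beta> * measure P ?B)
      \<le> (\<integral>\<^sup>+x. \<phi> (g n x) * indicator A x \<partial>P)" for n
    unfolding eq[OF g, symmetric]
    by (rule order_trans[OF ennreal_integral_le[OF int[OF g]]], intro nn_integral_mono)
       (auto simp: indicator_def minorant)
  have "((\<lambda>n. \<alpha> * (LINT x:?B|P. g n x) + \<beta> * measure P ?B)
      \<longlongrightarrow> \<alpha> * (LINT x:?B|P. h x) + \<beta> * measure P ?B) H"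
    by (intro tendsto_intros lim[rule_format] B)
  then have "\<forall>\<^sub>F n in H. \<alpha> * (LINT x:?B|P. h x) + \<beta> * measure P ?B - e
      < \<alpha> * (LINT x:?B|P. g n x) + \<beta> * measure P ?B"
    using e by (intro order_tendstoD) auto
  then show ?thesis
  proof eventually_elim
    case (elim n)
    then have "ennreal (\<alpha> * (LINT x:?B|P. h x) + \<beta> * measure P ?B)
        \<le> ennreal (max 0 (\<alpha> * (LINT x:?B|P. g n x) + \<beta> * measure P ?B) + e)"
      by (intro ennreal_leI) auto
    also have "\<dots> = ennreal (\<alpha> * (LINT x:?B|P. g n x) + \<beta> * measure P ?B) + ennreal e"
      using e by (subst ennreal_plus) (auto simp: max_def ennreal_neg)
    also have "\<dots> \<le> (\<integral>\<^sup>+x. \<phi> (g n x) * indicator A x \<partial>P) + ennreal e"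
      by (intro add_right_mono right)
    finally show ?case unfolding left .
  qed
qed

lemma SUP_affine_measurable:
  fixes \<phi> :: "real \<Rightarrow> ennreal" and \<alpha> \<beta> :: "nat \<Rightarrow> real"
  assumes "\<And>x. \<phi> x = (SUP i. ennreal (\<alpha> i * x + \<beta> i))"
  shows "\<phi> \<in> borel_measurable borel"
proof -
  have "\<phi> = (\<lambda>x. SUP i. ennreal (\<alpha> i * x + \<beta> i))" using assms by blast
  then show ?thesis by simp
qed

text \<open>By induction on the family of affine functions: \<open>A\<close> is split into the part where the new function is
  the largest at \<open>h\<close> and the rest. The integrals of \<open>\<phi> \<circ> g n\<close> over the two parts add up exactly,
  which is why the statement is proved for all \<open>A\<close> simultaneously.\<close>

lemma finite_SUP_affine_lower_semicontinuous:
  fixes g :: "nat \<Rightarrow> 'a \<Rightarrow> real" and \<alpha> \<beta> :: "nat \<Rightarrow> real"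
  assumes P: "finite_measure P" and g: "\<And>n. integrable P (g n)" and h: "integrable P h"
    and lim: "\<forall>A\<in>sets P. ((\<lambda>n. LINT x:A|P. g n x) \<longlongrightarrow> (LINT x:A|P. h x)) H"
    and \<phi>: "\<And>x. \<phi> x = (SUP i. ennreal (\<alpha> i * x + \<beta> i))"
    and "finite I" and A: "A \<in> sets P" and e: "0 < e"
  shows "\<forall>\<^sub>F n in H. (\<integral>\<^sup>+x. (SUP i\<in>I. ennreal (\<alpha> i * h x + \<beta> i)) * indicator A x \<partial>P)
     \<le> (\<integral>\<^sup>+x. \<phi> (g n x) * indicator A x \<partial>P) + ennreal e"
  using \<open>finite I\<close> A e
proof (induction I arbitrary: A e rule: finite_induct)
  case empty
  then show ?case by (simp add: bot_ennreal)
next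
  case (insert j I)
  have [measurable]: "\<phi> \<in> borel_measurable borel" by (rule SUP_affine_measurable[OF \<phi>])
  have [measurable]: "h \<in> borel_measurable P" "g n \<in> borel_measurable P" for n
    using g h by auto
  have [measurable]: "(\<lambda>x. SUP i\<in>I. ennreal (\<alpha> i * h x + \<beta> i)) \<in> borel_measurable P"
    using insert(1) by (intro borel_measurable_SUP) (auto intro: countable_finite)
  note [measurable] = \<open>A \<in> sets P\<close>
  let ?u = "\<lambda>x. ennreal (\<alpha> j * h x + \<beta> j)" and ?m = "\<lambda>x. SUP i\<in>I. ennreal (\<alpha> i * h x + \<beta> i)"
  let ?S = "{x\<in>space P. ?m x \<le> ?u x}"
  have max: "(SUP i\<in>insert j I. ennreal (\<alpha> i * h x + \<beta> i)) = (if ?m x \<le> ?u x then ?u x else ?m x)" for x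
    by (cases "?m x \<le> ?u x") (auto simp: sup.absorb1 sup.absorb2)
  have S: "A \<inter> ?S \<in> sets P" "A - ?S \<in> sets P" by measurable
  have "(\<integral>\<^sup>+x. (SUP i\<in>insert j I. ennreal (\<alpha> i * h x + \<beta> i)) * indicator A x \<partial>P)
      = (\<integral>\<^sup>+x. ?u x * indicator (A \<inter> ?S) x + ?m x * indicator (A - ?S) x \<partial>P)"
    by (intro nn_integral_cong) (unfold max, simp add: indicator_def)
  also have "\<dots> = (\<integral>\<^sup>+x. ?u x * indicator (A \<inter> ?S) x \<partial>P) + (\<integral>\<^sup>+x. ?m x * indicator (A - ?S) x \<partial>P)"
    using S by (intro nn_integral_add) measurable
  finally have left: "(\<integral>\<^sup>+x. (SUP i\<in>insert j I. ennreal (\<alpha> i * h x + \<beta> i)) * indicator A x \<partial>P) = \<dots>" .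
  have right: "(\<integral>\<^sup>+x. \<phi> (g n x) * indicator A x \<partial>P)
      = (\<integral>\<^sup>+x. \<phi> (g n x) * indicator (A \<inter> ?S) x \<partial>P) + (\<integral>\<^sup>+x. \<phi> (g n x) * indicator (A - ?S) x \<partial>P)" for n
    using S by (subst nn_integral_add[symmetric]) (auto intro!: nn_integral_cong simp: indicator_def)
  have minorant: "ennreal (\<alpha> j * y + \<beta> j) \<le> \<phi> y" for y
    unfolding \<phi> by (rule SUP_upper) auto
  have e2: "0 < e / 2" using \<open>0 < e\<close> by simp
  from affine_minorant_lower_semicontinuous[OF P g h lim minorant S(1) e2] insert.IH[OF S(2) e2]
  show ?case
  proof eventually_elim
    case (elim n)
    have "ennreal e = ennreal (e / 2) + ennreal (e / 2)"
      using \<open>0 < e\<close> by (simp flip: ennreal_plus)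
    with add_mono[OF elim] show ?case unfolding left right by (simp add: ac_simps)
  qed
qed

text \<open>\<open>\<phi>\<close> is the increasing limit of maxima of finitely many affine functions, so monotone convergence
  reduces the claim to these maxima.\<close>

lemma weak_lower_semicontinuous:
  fixes g :: "nat \<Rightarrow> 'a \<Rightarrow> real" and \<alpha> \<beta> :: "nat \<Rightarrow> real"
  assumes P: "finite_measure P" and H: "H \<noteq> bot" and g: "\<And>n. integrable P (g n)" and h: "integrable P h"
    and lim: "\<forall>A\<in>sets P. ((\<lambda>n. LINT x:A|P. g n x) \<longlongrightarrow> (LINT x:A|P. h x)) H"
    and \<phi>: "\<And>x. \<phi> x = (SUP i. ennreal (\<alpha> i * x + \<beta> i))"
    and m: "\<And>e. 0 < e \<Longrightarrow> \<forall>\<^sub>F n in H. (\<integral>\<^sup>+x. \<phi> (g n x) \<partial>P) \<le> m + ennreal e"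
  shows "(\<integral>\<^sup>+x. \<phi> (h x) \<partial>P) \<le> m"
proof -
  have [measurable]: "h \<in> borel_measurable P"
    using h by auto
  let ?m = "\<lambda>N x. SUP i\<in>{..<N::nat}. ennreal (\<alpha> i * h x + \<beta> i)"
  have "(\<integral>\<^sup>+x. ?m N x \<partial>P) \<le> m" for N
  proof (rule ennreal_le_epsilon)
    fix e :: real assume e: "0 < e"
    then have e2: "0 < e / 2" by simp
    have "\<forall>\<^sub>F n in H. (\<integral>\<^sup>+x. ?m N x \<partial>P) \<le> m + ennreal e"
      using finite_SUP_affine_lower_semicontinuous[OF P g h lim \<phi> finite_lessThan sets.top e2, of N] m[OF e2]
    proof eventually_elim
      case (elim n)
      have sp: "(\<integral>\<^sup>+x. u x * indicator (space P) x \<partial>P) = (\<integral>\<^sup>+x. u x \<partial>P)" for u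
        by (intro nn_integral_cong) simp
      have "ennreal e = ennreal (e / 2) + ennreal (e / 2)"
        using e by (simp flip: ennreal_plus)
      moreover have "(\<integral>\<^sup>+x. ?m N x \<partial>P) \<le> m + ennreal (e / 2) + ennreal (e / 2)"
        using elim unfolding sp by (meson add_right_mono order_trans)
      ultimately show ?case by (simp only: add.assoc)
    qed
    from eventually_happens'[OF H this] show "(\<integral>\<^sup>+x. ?m N x \<partial>P) \<le> m + ennreal e" by simp
  qed
  moreover have "(\<integral>\<^sup>+x. \<phi> (h x) \<partial>P) = (SUP N. \<integral>\<^sup>+x. ?m N x \<partial>P)"
  proof -
    have "\<phi> (h x) = (SUP N. ?m N x)" for x
    proof (rule antisym)
      show "\<phi> (h x) \<le> (SUP N. ?m N x)" unfolding \<phi>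
      proof (rule SUP_least)
        fix i
        have "ennreal (\<alpha> i * h x + \<beta> i) \<le> ?m (Suc i) x" by (rule SUP_upper) auto
        also have "\<dots> \<le> (SUP N. ?m N x)" by (rule SUP_upper) auto
        finally show "ennreal (\<alpha> i * h x + \<beta> i) \<le> (SUP N. ?m N x)" .
      qed
      show "(SUP N. ?m N x) \<le> \<phi> (h x)" unfolding \<phi>
        by (intro SUP_least) (auto intro: SUP_upper)
    qed
    then have "(\<integral>\<^sup>+x. \<phi> (h x) \<partial>P) = (\<integral>\<^sup>+x. (SUP N. ?m N x) \<partial>P)" by simp
    also have "\<dots> = (SUP N. \<integral>\<^sup>+x. ?m N x \<partial>P)"
    proof (rule nn_integral_monotone_convergence_SUP)
      show "incseq ?m" by (auto simp: incseq_def le_fun_def intro!: SUP_subset_mono)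
      show "?m N \<in> borel_measurable P" for N
        by (intro borel_measurable_SUP) auto
    qed
    finally show ?thesis .
  qed
  ultimately show ?thesis by (auto intro: SUP_least)
qed

section \<open>Setwise limits along a filter\<close>

text \<open>The sequence takes its values in a product of compact intervals, hence has a cluster point \<open>l\<close>.
  The neighbourhoods of \<open>l\<close>, pulled back along \<open>q\<close>, together with the tails of the natural numbers
  generate the filter. It plays the role of a convergent subsequence,
  which may not exist when the index set is uncountable.\<close>

lemma cluster_filter_of_bounded_sequence:
  fixes q :: "nat \<Rightarrow> 'b \<Rightarrow> real"
  assumes C: "\<And>n A. \<bar>q n A\<bar> \<le> C"
  obtains H l where "H \<noteq> bot" "H \<le> sequentially" "\<And>A. ((\<lambda>n. q n A) \<longlongrightarrow> l A) H"
proof -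
  let ?K = "PiE UNIV (\<lambda>_::'b. {-C..C})"
  have "compactin (product_topology (\<lambda>_. euclidean) UNIV) ?K"
    by (simp add: compactin_PiE)
  then have "compact ?K"
    by (simp add: euclidean_product_topology)
  moreover have "eventually (\<lambda>f. f \<in> ?K) (filtermap q sequentially)"
    using C by (simp add: eventually_filtermap PiE_def abs_le_iff minus_le_iff)
  ultimately obtain l where l: "inf (nhds l) (filtermap q sequentially) \<noteq> bot"
    unfolding compact_filter by (metis filtermap_bot_iff trivial_limit_sequentially)
  let ?H = "inf sequentially (filtercomap q (nhds l))"
  have "?H \<noteq> bot"
  proof
    assume "?H = bot"
    then have "eventually (\<lambda>_. False) ?H" by simp
    then obtain S R where S: "eventually S sequentially" and R: "eventually R (filtercomap q (nhds l))"
      and SR: "\<And>n. S n \<and> R n \<longrightarrow> False"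
      unfolding eventually_inf by blast
    then obtain T where T: "eventually T (nhds l)" "\<And>n. T (q n) \<Longrightarrow> R n"
      unfolding eventually_filtercomap by blast
    have "eventually (\<lambda>y. \<not> T y) (filtermap q sequentially)"
      unfolding eventually_filtermap using S by eventually_elim (use T SR in blast)
    with T(1) have "eventually (\<lambda>_. False) (inf (nhds l) (filtermap q sequentially))"
      unfolding eventually_inf by blast
    with l show False by (simp add: trivial_limit_def)
  qed
  moreover have "?H \<le> sequentially" by simp
  moreover have "((\<lambda>n. q n A) \<longlongrightarrow> l A) ?H" for A
  proof -
    have "filterlim q (nhds l) (filtercomap q (nhds l))"
      by (rule filterlim_filtercomap)
    then have "filterlim q (nhds l) ?H"
      by (rule filterlim_mono) auto
    with continuous_on_product_coordinates[of A] show ?thesis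
      by (rule continuous_on_tendsto_compose) auto
  qed
  ultimately show thesis by (rule that)
qed

text \<open>The assumption \<open>small\<close> is a form of uniform absolute continuity with respect to \<open>P\<close>: it makes
  \<open>l\<close> small on the remainders of a countable disjoint union, and zero on null sets. It passes to setwise
  limits because the constant \<open>C\<close> depends on \<open>e\<close> only.\<close>

lemma signed_measure_of_uniformly_small:
  assumes "finite_measure P"
    and add: "\<And>A B. A \<in> sets P \<Longrightarrow> B \<in> sets P \<Longrightarrow> A \<inter> B = {} \<Longrightarrow> l (A \<union> B) = l A + l B"
    and outside: "\<And>A. A \<notin> sets P \<Longrightarrow> l A = 0"
    and small: "\<And>e. 0 < e \<Longrightarrow> \<exists>C. \<forall>A\<in>sets P. \<bar>l A\<bar> \<le> C * measure P A + e"
  shows "l \<in> signed_measures P" "signed_ac P l"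
proof -
  interpret finite_measure P by fact
  have null: "l A = 0" if "A \<in> sets P" "measure P A = 0" for A
  proof -
    have "\<bar>l A\<bar> \<le> 0 + e" if "0 < e" for e
      using small[OF that] \<open>A \<in> sets P\<close> \<open>measure P A = 0\<close> by force
    then have "\<bar>l A\<bar> \<le> 0" by (rule field_le_epsilon)
    then show ?thesis by simp
  qed
  then show "signed_ac P l" by (auto simp: signed_ac_def measure_def)
  have empty: "l {} = 0" by (rule null) auto
  have "(\<lambda>i. l (A i)) sums l (\<Union>i. A i)" if A: "range A \<subseteq> sets P" "disjoint_family A" for A :: "nat \<Rightarrow> 'a set"
  proof -
    let ?U = "\<Union>i. A i" and ?R = "\<lambda>n. (\<Union>i. A i) - (\<Union>i<n. A i)"
    have [measurable]: "A i \<in> sets P" for i using A by auto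
    \<comment> \<open>Stated for arbitrary \<open>m\<close>, to be used for \<open>l\<close> and for \<open>P\<close>.\<close>
    have fin: "m (\<Union>i<n. A i) = (\<Sum>i<n. m (A i))"
      if "m {} = 0" "\<And>A B. A \<in> sets P \<Longrightarrow> B \<in> sets P \<Longrightarrow> A \<inter> B = {} \<Longrightarrow> m (A \<union> B) = m A + m B"
      for m :: "'a set \<Rightarrow> real" and n
    proof (induction n)
      case (Suc n)
      have "A i \<inter> A n = {}" if "i < n" for i
        using A(2) that by (intro disjoint_family_onD[of A UNIV]) auto
      then have "(\<Union>i<n. A i) \<inter> A n = {}" by blast
      then have "m ((\<Union>i<n. A i) \<union> A n) = m (\<Union>i<n. A i) + m (A n)"
        by (intro that(2)) auto
      then show ?case by (simp add: lessThan_Suc Un_commute Suc)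
    qed (simp add: that(1))
    have split: "m ?U = (\<Sum>i<n. m (A i)) + m (?R n)"
      if "m {} = 0" "\<And>A B. A \<in> sets P \<Longrightarrow> B \<in> sets P \<Longrightarrow> A \<inter> B = {} \<Longrightarrow> m (A \<union> B) = m A + m B"
      for m :: "'a set \<Rightarrow> real" and n
    proof -
      have "m ((\<Union>i<n. A i) \<union> ?R n) = m (\<Union>i<n. A i) + m (?R n)"
        by (intro that(2)) auto
      also have "(\<Union>i<n. A i) \<union> ?R n = ?U" by auto
      finally show ?thesis by (simp add: fin[OF that])
    qed
    have "measure P (?R n) = measure P ?U - (\<Sum>i<n. measure P (A i))" for n
      using split[of "measure P" n] by (auto simp: finite_measure_Union)
    moreover have "(\<lambda>n. measure P ?U - (\<Sum>i<n. measure P (A i))) \<longlonglongrightarrow> measure P ?U - measure P ?U"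
      using finite_measure_UNION[OF A] unfolding sums_def by (intro tendsto_intros)
    ultimately have PR: "(\<lambda>n. measure P (?R n)) \<longlonglongrightarrow> 0" by simp
    have "(\<lambda>n. l (?R n)) \<longlonglongrightarrow> 0"
    proof (rule LIMSEQ_I)
      fix e :: real assume e: "0 < e"
      then obtain C where C: "\<And>A. A \<in> sets P \<Longrightarrow> \<bar>l A\<bar> \<le> C * measure P A + e / 2"
        using small[of "e / 2"] by auto
      have "(\<lambda>n. C * measure P (?R n)) \<longlonglongrightarrow> C * 0"
        by (intro tendsto_intros PR)
      then obtain N where "\<forall>n\<ge>N. norm (C * measure P (?R n) - C * 0) < e / 2"
        using LIMSEQ_D[of _ _ "e / 2"] e half_gt_zero by blast
      then have N: "\<And>n. n \<ge> N \<Longrightarrow> C * measure P (?R n) < e / 2"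
        by (auto simp: abs_less_iff)
      have "norm (l (?R n) - 0) < e" if "n \<ge> N" for n
        using N[OF that] C[of "?R n"] by auto
      then show "\<exists>no. \<forall>n\<ge>no. norm (l (?R n) - 0) < e" by blast
    qed
    then have "(\<lambda>n. l ?U - l (?R n)) \<longlonglongrightarrow> l ?U - 0"
      by (intro tendsto_intros)
    moreover have "l ?U - l (?R n) = (\<Sum>i<n. l (A i))" for n
      using split[of l n] empty add by simp
    ultimately show ?thesis unfolding sums_def by simp
  qed
  with empty outside show "l \<in> signed_measures P"
    unfolding signed_measures_def by blast
qed

section \<open>Bounded sets of densities in the space L_r\<close>

definition Lr_ball :: "'a measure \<Rightarrow> real \<Rightarrow> real \<Rightarrow> ('a \<Rightarrow> real) set" where
  "Lr_ball P r K = {g \<in> borel_measurable P. integrable P (\<lambda>x. \<bar>g x\<bar> powr r) \<and>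
     (LINT x|P. \<bar>g x\<bar> powr r) \<le> K}"

text \<open>Either \<open>x\<close> is below the level \<open>C\<close>, or the tail term dominates it since \<open>1 - r \<le> 0\<close>.\<close>

lemma abs_le_level_plus_tail:
  fixes x C r :: real
  assumes "0 < C" "1 \<le> r"
  shows "\<bar>x\<bar> \<le> C + C powr (1 - r) * \<bar>x\<bar> powr r"
proof (cases "\<bar>x\<bar> \<le> C")
  case False
  then have "\<bar>x\<bar> = \<bar>x\<bar> powr (1 - r) * \<bar>x\<bar> powr r"
    using assms by (simp flip: powr_add)
  also have "\<dots> \<le> C powr (1 - r) * \<bar>x\<bar> powr r"
    using False assms by (intro mult_right_mono powr_mono2') auto
  finally show ?thesis using assms by simp
qed (simp add: add_increasing2)

text \<open>The usual proof that a bounded set in \<open>L\<^sub>r\<close> is uniformly integrable: the second summand is small for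
  large \<open>C\<close> when \<open>r > 1\<close>, uniformly over the ball.\<close>

lemma Lr_ball_set_integral_bound:
  assumes "finite_measure P" and g: "g \<in> Lr_ball P r K" and C: "0 < C" "1 \<le> r" and A: "A \<in> sets P"
  shows "integrable P g" "\<bar>LINT x:A|P. g x\<bar> \<le> C * measure P A + C powr (1 - r) * K"
proof -
  interpret finite_measure P by fact
  have [measurable]: "g \<in> borel_measurable P" and gr: "integrable P (\<lambda>x. \<bar>g x\<bar> powr r)"
    "(LINT x|P. \<bar>g x\<bar> powr r) \<le> K"
    using g by (auto simp: Lr_ball_def)
  note [measurable] = A
  show int: "integrable P g"
  proof (rule Bochner_Integration.integrable_bound)
    show "integrable P (\<lambda>x. C + C powr (1 - r) * \<bar>g x\<bar> powr r)"
      using gr by simp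
  qed (use abs_le_level_plus_tail[OF C] in \<open>auto intro!: AE_I2 order_trans[OF _ abs_ge_self]\<close>)
  have i1: "integrable P (indicator A :: _ \<Rightarrow> real)"
    by (simp add: less_top[symmetric])
  have "\<bar>LINT x:A|P. g x\<bar> \<le> (LINT x|P. C * indicator A x + C powr (1 - r) * \<bar>g x\<bar> powr r)"
    unfolding set_lebesgue_integral_def
  proof (rule order_trans[OF integral_abs_bound], rule integral_mono)
    show "integrable P (\<lambda>x. \<bar>indicator A x *\<^sub>R g x\<bar>)"
      using int by (intro integrable_abs integrable_mult_indicator) auto
    show "integrable P (\<lambda>x. C * indicator A x + C powr (1 - r) * \<bar>g x\<bar> powr r)"
      using gr i1 by simp
    show "\<bar>indicator A x *\<^sub>R g x\<bar> \<le> C * indicator A x + C powr (1 - r) * \<bar>g x\<bar> powr r" for x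
      using abs_le_level_plus_tail[OF C, of "g x"] by (auto simp: indicator_def)
  qed
  also have "\<dots> = C * measure P A + C powr (1 - r) * (LINT x|P. \<bar>g x\<bar> powr r)"
    using gr i1 by simp
  also have "\<dots> \<le> C * measure P A + C powr (1 - r) * K"
    using gr by (intro add_left_mono mult_left_mono) auto
  finally show "\<bar>LINT x:A|P. g x\<bar> \<le> C * measure P A + C powr (1 - r) * K" .
qed

lemma ex_small_tail:
  fixes r K e :: real
  assumes "1 < r" "0 < e"
  obtains C where "0 < C" "C powr (1 - r) * K \<le> e"
proof -
  have "((\<lambda>C. C powr (1 - r) * K) \<longlongrightarrow> 0 * K) at_top"
    using assms by (intro tendsto_intros tendsto_neg_powr filterlim_ident) auto
  then have "\<forall>\<^sub>F C in at_top. C powr (1 - r) * K < e"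
    using assms by (intro order_tendstoD) auto
  then have "\<forall>\<^sub>F C in at_top. C powr (1 - r) * K < e \<and> 0 < C"
    using eventually_gt_at_top[of 0] by (rule eventually_conj)
  from eventually_happens'[OF _ this] that show thesis by (auto intro: less_imp_le)
qed

lemma weak_limit_signed_measure:
  assumes "finite_measure P" and H: "H \<noteq> bot" and r: "1 < r"
    and dens: "\<And>n. signed_density P (Q n) (g n)" and g: "\<And>n. g n \<in> Lr_ball P r K"
    and lim: "\<And>A. ((\<lambda>n. Q n A) \<longlongrightarrow> l A) H"
  shows "l \<in> signed_measures P" "signed_ac P l"
proof -
  have add: "l (A \<union> B) = l A + l B" if "A \<in> sets P" "B \<in> sets P" "A \<inter> B = {}" for A B
  proof -
    have "Q n (A \<union> B) = Q n A + Q n B" for n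
      using signed_measures_Un[OF signed_densityD(1)[OF dens]] that by blast
    then have "((\<lambda>n. Q n A + Q n B) \<longlongrightarrow> l (A \<union> B)) H"
      using lim[of "A \<union> B"] by simp
    then show ?thesis
      using tendsto_add[OF lim[of A] lim[of B]] by (intro tendsto_unique[OF H])
  qed
  have outside: "l A = 0" if "A \<notin> sets P" for A
  proof -
    have "Q n A = 0" for n
      using signed_measures_outside[OF signed_densityD(1)[OF dens] that] .
    then show "l A = 0"
      using lim[of A] H by (simp add: tendsto_const_iff)
  qed
  have small: "\<exists>C. \<forall>A\<in>sets P. \<bar>l A\<bar> \<le> C * measure P A + e" if e: "0 < e" for e
  proof -
    from ex_small_tail[OF r e] obtain C where C: "0 < C" "C powr (1 - r) * K \<le> e" by metis
    have "\<bar>l A\<bar> \<le> C * measure P A + e" if A: "A \<in> sets P" for A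
    proof (rule tendsto_upperbound[OF tendsto_rabs[OF lim] _ H])
      have "\<bar>Q n A\<bar> \<le> C * measure P A + e" for n
        using Lr_ball_set_integral_bound(2)[OF assms(1) g C(1) _ A, of n] r C(2)
          signed_densityD(3)[OF dens A, of n] by simp
      then show "\<forall>\<^sub>F n in H. \<bar>Q n A\<bar> \<le> C * measure P A + e" by simp
    qed
    then show ?thesis by blast
  qed
  show "l \<in> signed_measures P" "signed_ac P l"
    using signed_measure_of_uniformly_small[OF assms(1) add outside small] by blast+
qed

text \<open>Young's inequality for \<open>u / d\<close> and \<open>d * v\<close>. The free parameter \<open>d\<close> allows one to make the
  term with \<open>v\<close> as small as desired.\<close>

lemma scaled_Young:
  fixes u v d r k :: real
  assumes "1 < r" "1 < k" "1 / r + 1 / k = 1" "0 < d"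
  shows "\<bar>u * v\<bar> \<le> d powr (-k) * \<bar>u\<bar> powr k + d powr r * \<bar>v\<bar> powr r"
proof -
  have "\<bar>u * v\<bar> = (\<bar>u\<bar> / d) * (d * \<bar>v\<bar>)"
    using assms by (simp add: abs_mult)
  also have "\<dots> \<le> (\<bar>u\<bar> / d) powr k / k + (d * \<bar>v\<bar>) powr r / r"
    using assms by (intro Youngs_inequality) (auto simp: add.commute)
  also have "\<dots> \<le> (\<bar>u\<bar> / d) powr k + (d * \<bar>v\<bar>) powr r"
    using assms by (intro add_mono) (auto simp: divide_le_eq intro!: mult_le_cancel_left1[THEN iffD2])
  also have "\<dots> = d powr (-k) * \<bar>u\<bar> powr k + d powr r * \<bar>v\<bar> powr r"
    using assms by (simp add: powr_divide powr_mult powr_minus field_simps)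
  finally show ?thesis .
qed

lemma Holder_pairing_bound:
  assumes rk: "1 < r" "1 < k" "1 / r + 1 / k = 1"
    and f: "f \<in> borel_measurable P" "integrable P (\<lambda>x. \<bar>f x\<bar> powr k)" and g: "g \<in> Lr_ball P r K"
  shows "integrable P (\<lambda>x. f x * g x)"
    and "0 < d \<Longrightarrow> \<bar>LINT x|P. f x * g x\<bar> \<le> d powr (-k) * (LINT x|P. \<bar>f x\<bar> powr k) + d powr r * K"
proof -
  have gr: "g \<in> borel_measurable P" "integrable P (\<lambda>x. \<bar>g x\<bar> powr r)" "(LINT x|P. \<bar>g x\<bar> powr r) \<le> K"
    using g by (auto simp: Lr_ball_def)
  have int: "integrable P (\<lambda>x. d powr (-k) * \<bar>f x\<bar> powr k + d powr r * \<bar>g x\<bar> powr r)" for d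
    using f gr by simp
  show fg: "integrable P (\<lambda>x. f x * g x)"
    using scaled_Young[OF rk zero_less_one] f gr
    by (intro Bochner_Integration.integrable_bound[OF int[of 1]]) (auto intro!: AE_I2 order_trans[OF _ abs_ge_self])
  assume d: "0 < d"
  have "\<bar>LINT x|P. f x * g x\<bar> \<le> (LINT x|P. d powr (-k) * \<bar>f x\<bar> powr k + d powr r * \<bar>g x\<bar> powr r)"
    using scaled_Young[OF rk d] fg int
    by (intro order_trans[OF integral_abs_bound] integral_mono) auto
  also have "\<dots> = d powr (-k) * (LINT x|P. \<bar>f x\<bar> powr k) + d powr r * (LINT x|P. \<bar>g x\<bar> powr r)"
    using f gr by simp
  also have "\<dots> \<le> d powr (-k) * (LINT x|P. \<bar>f x\<bar> powr k) + d powr r * K"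
    using gr by (intro add_left_mono mult_left_mono) auto
  finally show "\<bar>LINT x|P. f x * g x\<bar> \<le> d powr (-k) * (LINT x|P. \<bar>f x\<bar> powr k) + d powr r * K" .
qed

lemma simple_function_integral_mult:
  fixes s g :: "'a \<Rightarrow> real"
  assumes s: "simple_function P s" and g: "integrable P g"
  shows "(LINT x|P. s x * g x) = (\<Sum>y\<in>s ` space P. y * (LINT x:(s -` {y} \<inter> space P)|P. g x))"
proof -
  have fin: "finite (s ` space P)" and meas: "\<And>y. s -` {y} \<inter> space P \<in> sets P"
    using simple_functionD[OF s] by auto
  have "(LINT x|P. s x * g x) = (LINT x|P. (\<Sum>y\<in>s ` space P. y * (indicator (s -` {y} \<inter> space P) x * g x)))"
  proof (rule Bochner_Integration.integral_cong[OF refl])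
    fix x assume x: "x \<in> space P"
    have "(\<Sum>y\<in>s ` space P. y * (indicator (s -` {y} \<inter> space P) x * g x)) =
        (\<Sum>y\<in>s ` space P. if y = s x then y * g x else 0)"
      using x by (intro sum.cong) (auto simp: indicator_def)
    also have "\<dots> = s x * g x"
      using x fin by (simp add: sum.delta)
    finally show "s x * g x = (\<Sum>y\<in>s ` space P. y * (indicator (s -` {y} \<inter> space P) x * g x))" ..
  qed
  also have "\<dots> = (\<Sum>y\<in>s ` space P. y * (LINT x:(s -` {y} \<inter> space P)|P. g x))"
    using integrable_mult_indicator[OF meas g]
    by (subst Bochner_Integration.integral_sum) (auto simp: set_lebesgue_integral_def)
  finally show ?thesis .
qed

lemma simple_function_dense_Lk:
  fixes f :: "'a \<Rightarrow> real"
  assumes f: "f \<in> borel_measurable P" "integrable P (\<lambda>x. \<bar>f x\<bar> powr k)" and k: "0 < k" and e: "0 < e"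
  obtains s where "simple_function P s" "integrable P (\<lambda>x. \<bar>s x\<bar> powr k)"
    "integrable P (\<lambda>x. \<bar>f x - s x\<bar> powr k)" "(LINT x|P. \<bar>f x - s x\<bar> powr k) < e"
proof -
  obtain s :: "nat \<Rightarrow> 'a \<Rightarrow> real" where s: "\<forall>i. simple_function P (s i)"
     "\<forall>x\<in>space P. (\<lambda>i. s i x) \<longlonglongrightarrow> f x" "\<forall>i. \<forall>x\<in>space P. dist (s i x) 0 \<le> 2 * dist (f x) 0"
    using borel_measurable_implies_sequence_metric[OF f(1)] by blast
  have sm: "s i \<in> borel_measurable P" for i
    using s(1) by (auto intro: borel_measurable_simple_function)
  have bd: "integrable P (\<lambda>x. 3 powr k * \<bar>f x\<bar> powr k)"
    using f by simp
  have le: "\<bar>h\<bar> powr k \<le> 3 powr k * \<bar>f x\<bar> powr k" if "\<bar>h\<bar> \<le> 3 * \<bar>f x\<bar>" for h x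
    using powr_mono2[of k "\<bar>h\<bar>" "3 * \<bar>f x\<bar>"] that k by (simp add: powr_mult)
  have le1: "\<bar>s i x\<bar> \<le> 3 * \<bar>f x\<bar>" and le2: "\<bar>f x - s i x\<bar> \<le> 3 * \<bar>f x\<bar>" if "x \<in> space P" for i x
  proof -
    have "\<bar>s i x\<bar> \<le> 2 * \<bar>f x\<bar>" using s(3) that by (simp add: dist_real_def)
    then show "\<bar>s i x\<bar> \<le> 3 * \<bar>f x\<bar>" "\<bar>f x - s i x\<bar> \<le> 3 * \<bar>f x\<bar>" by linarith+
  qed
  have i1: "integrable P (\<lambda>x. \<bar>s i x\<bar> powr k)" for i
    using sm le le1 by (intro Bochner_Integration.integrable_bound[OF bd]) auto
  have i2: "integrable P (\<lambda>x. \<bar>f x - s i x\<bar> powr k)" for i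
    using sm f le le2 by (intro Bochner_Integration.integrable_bound[OF bd]) auto
  have "(\<lambda>i. LINT x|P. \<bar>f x - s i x\<bar> powr k) \<longlonglongrightarrow> (LINT x|P. 0)"
  proof (rule integral_dominated_convergence[OF _ _ bd])
    show "AE x in P. (\<lambda>i. \<bar>f x - s i x\<bar> powr k) \<longlonglongrightarrow> 0"
    proof (rule AE_I2)
      fix x assume "x \<in> space P"
      then have "(\<lambda>i. \<bar>f x - s i x\<bar>) \<longlonglongrightarrow> \<bar>f x - f x\<bar>"
        using s(2) by (intro tendsto_intros) auto
      then show "(\<lambda>i. \<bar>f x - s i x\<bar> powr k) \<longlonglongrightarrow> 0"
        using k by (intro tendsto_zero_powrI[where b=k]) auto
    qed
    show "AE x in P. norm (\<bar>f x - s i x\<bar> powr k) \<le> 3 powr k * \<bar>f x\<bar> powr k" for i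
      using le le2 by (intro AE_I2) simp
  qed (use f sm in auto)
  then have "\<forall>\<^sub>F i in sequentially. (LINT x|P. \<bar>f x - s i x\<bar> powr k) < e"
    using e by (intro order_tendstoD) auto
  then obtain i where "(LINT x|P. \<bar>f x - s i x\<bar> powr k) < e"
    by (auto simp: eventually_sequentially)
  with that[of "s i"] s(1) i1 i2 show thesis by blast
qed

text \<open>For a simple function in place of \<open>f\<close> the convergence is that of finitely many set integrals. A general
  \<open>f\<close> is replaced by a simple function at a cost that is uniform over the ball: in the scaled
  Young bound, \<open>d\<close> is chosen first to make the term with \<open>K\<close> small, and the simple function
  afterwards, depending on \<open>d\<close>.\<close>

lemma tendsto_pairing_Lk:
  fixes f :: "'a \<Rightarrow> real"
  assumes "finite_measure P" and rk: "1 < r" "1 < k" "1 / r + 1 / k = 1"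
    and g: "\<And>n. g n \<in> Lr_ball P r K" and h: "h \<in> Lr_ball P r K"
    and lim: "\<And>A. A \<in> sets P \<Longrightarrow> ((\<lambda>n. LINT x:A|P. g n x) \<longlongrightarrow> (LINT x:A|P. h x)) H"
    and f: "f \<in> borel_measurable P" "integrable P (\<lambda>x. \<bar>f x\<bar> powr k)"
  shows "((\<lambda>n. LINT x|P. f x * g n x) \<longlongrightarrow> (LINT x|P. f x * h x)) H"
proof (rule tendstoI)
  fix e :: real assume e: "0 < e"
  have int: "integrable P u" if "u \<in> Lr_ball P r K" for u
    using Lr_ball_set_integral_bound(1)[OF assms(1) that, of 1] rk by auto
  have "((\<lambda>d. d powr r * K) \<longlongrightarrow> 0 powr r * K) (at_right 0)"
    using rk by (intro tendsto_intros) (auto intro!: eventually_mono[OF eventually_at_right_less])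
  then have "\<forall>\<^sub>F d in at_right 0. d powr r * K < e / 6"
    using e rk by (intro order_tendstoD) auto
  then have "\<forall>\<^sub>F d in at_right (0::real). d powr r * K < e / 6 \<and> 0 < d"
    using eventually_at_right_less[of 0] by (rule eventually_conj)
  then obtain d where d: "0 < d" "d powr r * K < e / 6"
    using eventually_happens'[OF trivial_limit_at_right_real] by blast
  obtain s where s: "simple_function P s" "integrable P (\<lambda>x. \<bar>s x\<bar> powr k)"
    "integrable P (\<lambda>x. \<bar>f x - s x\<bar> powr k)" "(LINT x|P. \<bar>f x - s x\<bar> powr k) < d powr k * (e / 6)"
    using simple_function_dense_Lk[OF f, of "d powr k * (e / 6)"] d e rk by auto
  have sm: "s \<in> borel_measurable P"
    using s(1) by (rule borel_measurable_simple_function)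
  have close: "\<bar>(LINT x|P. f x * u x) - (LINT x|P. s x * u x)\<bar> < e / 3" if u: "u \<in> Lr_ball P r K" for u
  proof -
    have "(LINT x|P. f x * u x) - (LINT x|P. s x * u x) = (LINT x|P. (f x - s x) * u x)"
      using Holder_pairing_bound(1)[OF rk f u] Holder_pairing_bound(1)[OF rk sm s(2) u]
      by (simp add: left_diff_distrib)
    also have "\<bar>\<dots>\<bar> \<le> d powr (-k) * (LINT x|P. \<bar>f x - s x\<bar> powr k) + d powr r * K"
      using sm f by (intro Holder_pairing_bound(2)[OF rk _ s(3) u d(1)]) auto
    also have "\<dots> < d powr (-k) * (d powr k * (e / 6)) + e / 6"
      using d s(4) by (intro add_strict_mono mult_strict_left_mono) auto
    also have "\<dots> = e / 3"
      using d by (simp add: powr_minus)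
    finally show ?thesis .
  qed
  have "((\<lambda>n. LINT x|P. s x * g n x) \<longlongrightarrow> (LINT x|P. s x * h x)) H"
    unfolding simple_function_integral_mult[OF s(1) int[OF g]] simple_function_integral_mult[OF s(1) int[OF h]]
    using simple_functionD[OF s(1)] by (intro tendsto_intros lim) auto
  then have "\<forall>\<^sub>F n in H. dist (LINT x|P. s x * g n x) (LINT x|P. s x * h x) < e / 3"
    using e by (intro tendstoD) auto
  then show "\<forall>\<^sub>F n in H. dist (LINT x|P. f x * g n x) (LINT x|P. f x * h x) < e"
  proof eventually_elim
    case (elim n)
    then show ?case using close[OF g[of n]] close[OF h] unfolding dist_real_def by linarith
  qed
qed

section \<open>Convergence in the topology generated by test functions\<close>

text \<open>Convergence in a topology generated by a subbase need only be tested on the subbase.\<close>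

lemma limitin_tau_topology:
  assumes Q: "\<And>n. Q n \<in> signed_measures_on P F" and l: "l \<in> signed_measures_on P F"
    and lim: "\<And>f. f \<in> F \<union> bounded_measurable P \<Longrightarrow>
       ((\<lambda>n. signed_integral P (Q n) f) \<longlongrightarrow> signed_integral P l f) H"
  shows "limitin (tau_topology P F) Q l H"
  unfolding limitin_def
proof (intro conjI allI impI)
  show "l \<in> topspace (tau_topology P F)" using l by (simp add: topspace_tau_topology)
  fix U assume U: "openin (tau_topology P F) U \<and> l \<in> U"
  then have "generate_topology_on {{Q \<in> signed_measures_on P F. signed_integral P Q f \<in> U} | f U.
        f \<in> F \<union> bounded_measurable P \<and> open U} U"
    by (simp add: tau_topology_def openin_topology_generated_by_iff)
  then have "l \<in> U \<longrightarrow> eventually (\<lambda>n. Q n \<in> U) H"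
  proof (induction rule: generate_topology_on.induct)
    case (Int a b)
    then show ?case by (auto intro: eventually_conj)
  next
    case (UN K)
    show ?case
    proof
      assume "l \<in> \<Union>K"
      then obtain X where X: "X \<in> K" "l \<in> X" by blast
      with UN have "eventually (\<lambda>n. Q n \<in> X) H" by blast
      then show "eventually (\<lambda>n. Q n \<in> \<Union>K) H"
        by (rule eventually_mono) (use X in blast)
    qed
  next
    case (Basis s)
    then obtain f V where s: "s = {Q \<in> signed_measures_on P F. signed_integral P Q f \<in> V}"
      "f \<in> F \<union> bounded_measurable P" "open V" by blast
    show ?case
      using topological_tendstoD[OF lim[OF s(2)] s(3)] Q unfolding s(1) by simp
  qed simp
  with U show "eventually (\<lambda>n. Q n \<in> U) H" by blast
qed

lemma Lp_norm_finite_integrable: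
  assumes "f \<in> borel_measurable P" "Lp_norm k P f < \<infinity>"
  shows "integrable P (\<lambda>x. \<bar>f x\<bar> powr k)"
proof (rule integrableI_nonneg)
  show "(\<integral>\<^sup>+x. ennreal (\<bar>f x\<bar> powr k) \<partial>P) < \<infinity>"
    using assms(2) by (auto simp: Lp_norm_def Let_def less_top split: if_splits)
qed (use assms in auto)

lemma bounded_measurable_integrable_powr:
  assumes "finite_measure P" "f \<in> bounded_measurable P" "0 \<le> k"
  shows "f \<in> borel_measurable P" "integrable P (\<lambda>x. \<bar>f x\<bar> powr k)"
proof -
  interpret finite_measure P by fact
  obtain C where f: "f \<in> borel_measurable P" "\<And>x. x \<in> space P \<Longrightarrow> \<bar>f x\<bar> \<le> C"
    using assms(2) by (auto simp: bounded_measurable_def)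
  show "f \<in> borel_measurable P" by fact
  show "integrable P (\<lambda>x. \<bar>f x\<bar> powr k)"
    using f assms(3) by (intro integrable_const_bound[of _ "C powr k"]) (auto intro!: AE_I2 powr_mono2)
qed

lemma Lr_ball_of_divergence_bound:
  assumes P: "prob_space P" and g: "g \<in> borel_measurable P" and \<phi>: "\<phi> \<in> borel_measurable borel"
    and c: "0 < c" "0 \<le> R" "\<And>x. ennreal (c * \<bar>x\<bar> powr r) \<le> \<phi> x + ennreal R"
    and N: "(\<integral>\<^sup>+x. \<phi> (g x) \<partial>P) \<le> ennreal N" "0 \<le> N"
  shows "g \<in> Lr_ball P r ((N + R) / c)"
proof -
  interpret prob_space P by fact
  note [measurable] = g \<phi>
  have "(\<integral>\<^sup>+x. ennreal (c * \<bar>g x\<bar> powr r) \<partial>P) \<le> (\<integral>\<^sup>+x. \<phi> (g x) + ennreal R \<partial>P)"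
    by (intro nn_integral_mono c)
  also have "\<dots> = (\<integral>\<^sup>+x. \<phi> (g x) \<partial>P) + ennreal R"
    by (subst nn_integral_add) (auto simp: emeasure_space_1)
  also have "\<dots> \<le> ennreal (N + R)"
    using N c by (simp add: add_right_mono)
  finally have le: "(\<integral>\<^sup>+x. ennreal (c * \<bar>g x\<bar> powr r) \<partial>P) \<le> ennreal (N + R)" .
  have int: "integrable P (\<lambda>x. c * \<bar>g x\<bar> powr r)"
    using le c by (intro integrableI_nonneg) (auto intro: le_less_trans)
  then have "integrable P (\<lambda>x. \<bar>g x\<bar> powr r)" using c by simp
  moreover have "c * (LINT x|P. \<bar>g x\<bar> powr r) \<le> N + R"
  proof -
    have "ennreal (LINT x|P. c * \<bar>g x\<bar> powr r) \<le> ennreal (N + R)"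
      using le int c by (subst nn_integral_eq_integral[symmetric]) auto
    then have "(LINT x|P. c * \<bar>g x\<bar> powr r) \<le> N + R"
      using N c by (subst (asm) ennreal_le_iff) auto
    then show ?thesis by simp
  qed
  ultimately show ?thesis
    using c by (simp add: Lr_ball_def field_simps)
qed

lemma signed_measures_onI:
  assumes dens: "signed_density P Q g"
    and fg: "\<And>f. f \<in> F \<Longrightarrow> f \<in> borel_measurable P" "\<And>f. f \<in> F \<Longrightarrow> integrable P (\<lambda>x. f x * g x)"
  shows "Q \<in> signed_measures_on P F"
  unfolding signed_measures_on_def
proof (intro CollectI conjI ballI)
  show "Q \<in> signed_measures P" using dens by (rule signed_densityD)
  fix f assume f: "f \<in> F"
  have "(\<integral>\<^sup>+x. ennreal \<bar>f x\<bar> \<partial>total_variation P Q) = (\<integral>\<^sup>+x. ennreal (norm (f x * g x)) \<partial>P)"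
    using fg(1)[OF f] by (subst nn_integral_total_variation[OF dens])
      (auto intro!: nn_integral_cong simp: abs_mult ennreal_mult mult.commute)
  also have "\<dots> < \<infinity>" using fg(2)[OF f] by (simp add: integrable_iff_bounded)
  finally show "(\<integral>\<^sup>+x. ennreal \<bar>f x\<bar> \<partial>total_variation P Q) < \<infinity>" .
qed

section \<open>Existence of the projection\<close>

theorem theorem2p11:
  fixes P :: "'a measure"
    and \<phi> :: "real \<Rightarrow> ennreal"
    and a b :: ereal
    and F :: "('a \<Rightarrow> real) set"
    and \<Omega> :: "('a set \<Rightarrow> real) set"
  assumes "prob_space P"
    and "divergence_function \<phi> a b"
    and "F \<subseteq> borel_measurable P"
    and "closedin (tau_topology P F) \<Omega>"
    and "phi_div_set \<phi> \<Omega> P < \<infinity>"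
    and "\<exists>r k :: real. 1 < r \<and> 1 < k \<and> 1 / r + 1 / k = 1 \<and>
           (\<exists>L::ennreal. L > 0 \<and> ((\<lambda>x. \<phi> x / ennreal (\<bar>x\<bar> powr r)) \<longlongrightarrow> L) at_infinity) \<and>
           (\<forall>f\<in>F. Lp_norm k P f < \<infinity>)"
  shows "\<exists>Q. phi_projection \<phi> P \<Omega> Q"
proof -
  interpret prob_space P by fact
  note P = finite_measure_axioms
  obtain r k :: real and L :: ennreal where rk: "1 < r" "1 < k" "1 / r + 1 / k = 1"
    and L: "0 < L" "((\<lambda>x. \<phi> x / ennreal (\<bar>x\<bar> powr r)) \<longlongrightarrow> L) at_infinity"
    and Fk: "\<And>f. f \<in> F \<Longrightarrow> Lp_norm k P f < \<infinity>"
    using assms(6) by blast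
  obtain c R where c: "0 < c" "0 \<le> R" "\<And>x. ennreal (c * \<bar>x\<bar> powr r) \<le> \<phi> x + ennreal R"
    using powr_growth[OF L] rk by auto
  obtain \<alpha> \<beta> :: "nat \<Rightarrow> real" where \<phi>: "\<And>x. \<phi> x = (SUP i. ennreal (\<alpha> i * x + \<beta> i))"
    using divergence_function_SUP_affine[OF assms(2)] by blast
  note \<phi>_meas = SUP_affine_measurable[OF \<phi>]
  define m where "m = phi_div_set \<phi> \<Omega> P"
  have m_fin: "m \<noteq> top" using assms(5) by (simp add: m_def less_top)
  define N where "N = enn2real m + 1"
  have "\<exists>Q\<in>\<Omega>. phi_div \<phi> Q P < m + ennreal (inverse (Suc n))" for n
  proof -
    have "m < m + ennreal (inverse (Suc n))"
      using m_fin by (cases m) (simp_all add: ennreal_less_iff flip: ennreal_plus)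
    then show ?thesis
      unfolding m_def phi_div_set_def by (simp add: INF_less_iff)
  qed
  then obtain Q where Q: "\<And>n. Q n \<in> \<Omega>" "\<And>n. phi_div \<phi> (Q n) P < m + ennreal (inverse (Suc n))"
    by metis
  define g where "g n = signed_RN_deriv P (Q n)" for n
  have Q_on: "Q n \<in> signed_measures_on P F" for n
    using closedin_subset[OF assms(4)] Q(1) by (auto simp: topspace_tau_topology)
  have ac: "signed_ac P (Q n)" for n
    using Q(2)[of n] by (auto simp: phi_div_def split: if_splits)
  have dens: "signed_density P (Q n) (g n)" for n
    using signed_Radon_Nikodym[OF P _ ac] Q_on unfolding g_def signed_measures_on_def by blast
  have \<phi>g: "(\<integral>\<^sup>+x. \<phi> (g n x) \<partial>P) < m + ennreal (inverse (Suc n))" for n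
    using Q(2)[of n] ac by (simp add: phi_div_def g_def)
  define K where "K = (N + R) / c"
  \<comment> \<open>The slack 1 covers all members of the minimising sequence, whose excess over \<open>m\<close> is at most 1.\<close>
  have ball: "u \<in> Lr_ball P r K" if "u \<in> borel_measurable P" "(\<integral>\<^sup>+x. \<phi> (u x) \<partial>P) \<le> m + ennreal 1" for u
  proof -
    have "m + ennreal 1 = ennreal N"
      using m_fin by (cases m) (simp_all add: N_def flip: ennreal_plus ennreal_1)
    then show ?thesis
      unfolding K_def using that
      by (intro Lr_ball_of_divergence_bound[OF assms(1) _ \<phi>_meas c]) (auto simp: N_def)
  qed
  have g_ball: "g n \<in> Lr_ball P r K" for n
  proof (rule ball)
    show "g n \<in> borel_measurable P" using signed_densityD(2)[OF dens] by auto
    have "(\<integral>\<^sup>+x. \<phi> (g n x) \<partial>P) \<le> m + ennreal (inverse (Suc n))" using \<phi>g by (rule less_imp_le)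
    also have "\<dots> \<le> m + ennreal 1"
      by (intro add_left_mono ennreal_leI) (simp add: inverse_le_1_iff)
    finally show "(\<integral>\<^sup>+x. \<phi> (g n x) \<partial>P) \<le> m + ennreal 1" .
  qed
  have K0: "0 \<le> K"
    unfolding K_def N_def using c by simp
  have "\<bar>Q n A\<bar> \<le> 1 + K" for n A
  proof (cases "A \<in> sets P")
    case True
    have "\<bar>LINT x:A|P. g n x\<bar> \<le> 1 * prob A + 1 powr (1 - r) * K"
      using rk by (intro Lr_ball_set_integral_bound(2)[OF P g_ball _ _ True]) auto
    then have "\<bar>Q n A\<bar> \<le> prob A + K"
      by (simp add: signed_densityD(3)[OF dens True])
    with prob_le_1[of A] show ?thesis by linarith
  next
    case False
    then show ?thesis
      using signed_measures_outside[OF signed_densityD(1)[OF dens] False] K0 by simp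
  qed
  then obtain H l where H: "H \<noteq> bot" "H \<le> sequentially" and lim: "\<And>A. ((\<lambda>n. Q n A) \<longlongrightarrow> l A) H"
    using cluster_filter_of_bounded_sequence[of Q] by blast
  note l = weak_limit_signed_measure[OF P H(1) rk(1) dens g_ball lim]
  define h where "h = signed_RN_deriv P l"
  have dens_l: "signed_density P l h"
    unfolding h_def by (rule signed_Radon_Nikodym[OF P l])
  have lim': "\<forall>A\<in>sets P. ((\<lambda>n. LINT x:A|P. g n x) \<longlongrightarrow> (LINT x:A|P. h x)) H"
  proof
    fix A assume A: "A \<in> sets P"
    show "((\<lambda>n. LINT x:A|P. g n x) \<longlongrightarrow> (LINT x:A|P. h x)) H"
      using lim[of A] unfolding signed_densityD(3)[OF dens A] signed_densityD(3)[OF dens_l A] .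
  qed
  \<comment> \<open>This bound comes before membership of \<open>h\<close> in the ball, which is derived from it.\<close>
  have \<phi>h: "(\<integral>\<^sup>+x. \<phi> (h x) \<partial>P) \<le> m"
  proof (rule weak_lower_semicontinuous[OF P H(1) _ _ lim' \<phi>])
    show "integrable P (g n)" for n using signed_densityD(2)[OF dens] .
    show "integrable P h" using signed_densityD(2)[OF dens_l] .
    fix e :: real assume "0 < e"
    then have "\<forall>\<^sub>F n in sequentially. inverse (real (Suc n)) < e"
      by (intro order_tendstoD(2)[OF LIMSEQ_inverse_real_of_nat])
    then have "\<forall>\<^sub>F n in sequentially. (\<integral>\<^sup>+x. \<phi> (g n x) \<partial>P) \<le> m + ennreal e"
    proof eventually_elim
      case (elim n)
      have "m + ennreal (inverse (Suc n)) \<le> m + ennreal e"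
        using elim by (intro add_left_mono ennreal_leI) auto
      with \<phi>g[of n] show ?case by (meson less_imp_le order_trans)
    qed
    then show "\<forall>\<^sub>F n in H. (\<integral>\<^sup>+x. \<phi> (g n x) \<partial>P) \<le> m + ennreal e"
      using H(2) by (rule filter_leD[rotated])
  qed
  have h_ball: "h \<in> Lr_ball P r K"
  proof (rule ball)
    show "h \<in> borel_measurable P" using signed_densityD(2)[OF dens_l] by auto
  qed (use \<phi>h in \<open>simp add: add_increasing2\<close>)
  have test: "f \<in> borel_measurable P" "integrable P (\<lambda>x. \<bar>f x\<bar> powr k)"
    if "f \<in> F \<union> bounded_measurable P" for f
    using that bounded_measurable_integrable_powr[OF P, of f k] Lp_norm_finite_integrable[of f P k]
      assms(3) Fk rk by auto
  have l_on: "l \<in> signed_measures_on P F"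
    using test by (intro signed_measures_onI[OF dens_l] Holder_pairing_bound(1)[OF rk _ _ h_ball]) auto
  have "limitin (tau_topology P F) Q l H"
  proof (rule limitin_tau_topology[OF Q_on l_on])
    fix f assume f: "f \<in> F \<union> bounded_measurable P"
    have "((\<lambda>n. LINT x|P. f x * g n x) \<longlongrightarrow> (LINT x|P. f x * h x)) H"
      using lim' by (intro tendsto_pairing_Lk[OF P rk g_ball h_ball _ test[OF f]]) auto
    moreover have "signed_integral P (Q n) f = (LINT x|P. f x * g n x)" for n
      by (rule signed_integral_of_density[OF dens test(1)[OF f] Holder_pairing_bound(1)[OF rk test[OF f] g_ball]])
    moreover have "signed_integral P l f = (LINT x|P. f x * h x)"
      by (rule signed_integral_of_density[OF dens_l test(1)[OF f] Holder_pairing_bound(1)[OF rk test[OF f] h_ball]])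
    ultimately show "((\<lambda>n. signed_integral P (Q n) f) \<longlongrightarrow> signed_integral P l f) H" by simp
  qed
  then have "l \<in> \<Omega>"
    using Q(1) H(1) by (intro limitin_closedin[OF _ assms(4)]) auto
  moreover have "phi_div \<phi> l P \<le> phi_div \<phi> Q P" if "Q \<in> \<Omega>" for Q
  proof -
    have "phi_div \<phi> l P \<le> m"
      using \<phi>h l(2) by (simp add: phi_div_def h_def)
    also have "m \<le> phi_div \<phi> Q P"
      unfolding m_def phi_div_set_def using that by (rule INF_lower)
    finally show ?thesis .
  qed
  ultimately show ?thesis unfolding phi_projection_def by blast
qed

end
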